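(* Let $G$ be a finite forest and let $e=\{u,v\}$ be any leaf of $G$, where $\deg u=1$. If $\deg v=n$ and $N(v)=\{u,v_1,\dots,v_{n-1}\}$, then for all $i\ge1$ and $j\ge0$ \[\beta_{i,j}(\mathcal{I}(G))=\beta_{i,j}(\mathcal{I}(T))+\sum_{l=0}^{i}\binom{n-1}{l}\,\beta_{i-l-1,\,j-2-l}(\mathcal{I}(H)),\] where $T=G\setminus\{u\}$ and $H=G\setminus\{u,v,v_1,\dots,v_{n-1}\}$.
   Context: A forest is a finite simple graph without cycles, not necessarily connected; a leaf is an edge with an endpoint of degree $1$. The vertices of $G$ are identified with the variables of $R=k[x_1,\dots,x_m]$, $k$ an arbitrary field, and $\mathcal{I}(G)=(\{x_ix_j\mid\{x_i,x_j\}\in E_G\})\subseteq R$ is the edge ideal; a graph without edges has edge ideal $(0)$, and edge ideals of subgraphs are viewed in $R$. $N(v)$ is the set of neighbors of $v$, and $G\setminus S$ is $G$ with the vertices of $S$ and all incident edges deleted. $\beta_{i,j}(I)=\dim_k\mathrm{Tor}_i^R(I,k)_j$ for $i\ge0$; by convention, for every ideal $I$ (including $(0)$), $\beta_{-1,0}(I)=1$ and $\beta_{-1,j}(I)=0$ for $j\ne0$. *)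

theory Defs
  imports Complex_Main "HOL-Library.Poly_Mapping" "HOL-Library.Function_Algebras"
begin

section \<open>Finite simple graphs and forests\<close>

record 'v graph =
  verts :: "'v set"
  edges :: "'v set set"

definition finite_simple_graph :: "'v graph \<Rightarrow> bool" where
  "finite_simple_graph G \<longleftrightarrow>
     finite (verts G) \<and> (\<forall>e \<in> edges G. e \<subseteq> verts G \<and> card e = 2)"

definition is_cycle :: "'v graph \<Rightarrow> 'v list \<Rightarrow> bool" where
  "is_cycle G xs \<longleftrightarrow> 3 \<le> length xs \<and> distinct xs \<and>
     (\<forall>i < length xs. {xs ! i, xs ! (Suc i mod length xs)} \<in> edges G)"

definition forest :: "'v graph \<Rightarrow> bool" where
  "forest G \<longleftrightarrow> finite_simple_graph G \<and> (\<nexists>xs. is_cycle G xs)"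

definition neighbors :: "'v graph \<Rightarrow> 'v \<Rightarrow> 'v set" where
  "neighbors G x = {y. {x, y} \<in> edges G}"

definition degree :: "'v graph \<Rightarrow> 'v \<Rightarrow> nat" where
  "degree G x = card {e \<in> edges G. x \<in> e}"

definition is_leaf :: "'v graph \<Rightarrow> 'v set \<Rightarrow> bool" where
  "is_leaf G e \<longleftrightarrow> e \<in> edges G \<and> (\<exists>x \<in> e. degree G x = 1)"

definition delete_verts :: "'v graph \<Rightarrow> 'v set \<Rightarrow> 'v graph" where
  "delete_verts G S = \<lparr>verts = verts G - S, edges = {e \<in> edges G. e \<inter> S = {}}\<rparr>"


section \<open>The polynomial ring and edge ideals\<close>

text \<open>
  The polynomial ring over the field \<open>'k\<close> whose variables are the elements of \<open>'v\<close>: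
  finitely supported maps from exponent vectors to coefficients, with the convolution product
  of the library.
\<close>

type_synonym ('v, 'k) mpoly = "('v \<Rightarrow>\<^sub>0 nat) \<Rightarrow>\<^sub>0 'k"

definition var :: "'v \<Rightarrow> ('v, 'k::field) mpoly" where
  "var x = Poly_Mapping.single (Poly_Mapping.single x 1) 1"

definition monomial_degree :: "('v \<Rightarrow>\<^sub>0 nat) \<Rightarrow> nat" where
  "monomial_degree m = (\<Sum>x \<in> Poly_Mapping.keys m. Poly_Mapping.lookup m x)"

text \<open>Degrees are integers; the zero polynomial is homogeneous of every degree.\<close>

definition homogeneous :: "int \<Rightarrow> ('v, 'k::field) mpoly \<Rightarrow> bool" where
  "homogeneous d p \<longleftrightarrow> (\<forall>m \<in> Poly_Mapping.keys p. int (monomial_degree m) = d)"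

text \<open>The ideal generated by a set is its span in the ring regarded as a module over itself.\<close>

lemma module_mpoly: "module ((*) :: ('v, 'k::field) mpoly \<Rightarrow> _)"
  by unfold_locales (simp_all add: algebra_simps)

definition edge_ideal :: "'v graph \<Rightarrow> ('v, 'k::field) mpoly set" where
  "edge_ideal G = module.span (*) {var x * var y | x y. {x, y} \<in> edges G}"


section \<open>Graded free resolutions\<close>

text \<open>
  The free module of rank \<open>r\<close> consists of the functions on \<open>nat\<close> vanishing outside
  \<open>{..<r}\<close>; an \<open>r \<times> s\<close> matrix acts from the free module of rank \<open>s\<close> to that of rank \<open>r\<close>.
\<close>

definition free_mod :: "nat \<Rightarrow> (nat \<Rightarrow> 'a::zero) set" where
  "free_mod r = {f. \<forall>b \<ge> r. f b = 0}"

definition mat_map :: "nat \<Rightarrow> nat \<Rightarrow> (nat \<Rightarrow> nat \<Rightarrow> 'a::comm_ring_1) \<Rightarrow> (nat \<Rightarrow> 'a) \<Rightarrow> nat \<Rightarrow> 'a" where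
  "mat_map r s A f = (\<lambda>a. if a < r then \<Sum>b<s. A a b * f b else 0)"

text \<open>
  Data of an augmented complex \<open>\<dots> \<rightarrow> F\<^sub>2 \<rightarrow> F\<^sub>1 \<rightarrow> F\<^sub>0 \<rightarrow> R\<close> of graded free
  modules of finite rank: \<open>F\<^sub>i\<close> is the direct sum of the \<open>R(-shift i b)\<close> for \<open>b < rk i\<close>,
  \<open>bd i\<close> is the matrix of \<open>F\<^sub>i\<^sub>+\<^sub>1 \<rightarrow> F\<^sub>i\<close>, and \<open>aug\<close> is the row of \<open>F\<^sub>0 \<rightarrow> R\<close>.
\<close>

record (overloaded) ('v, 'k) graded_complex =
  rk :: "nat \<Rightarrow> nat"
  shift :: "nat \<Rightarrow> nat \<Rightarrow> int"
  aug :: "nat \<Rightarrow> ('v, 'k) mpoly"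
  bd :: "nat \<Rightarrow> nat \<Rightarrow> nat \<Rightarrow> ('v, 'k) mpoly"

definition aug_map ::
    "('v, 'k::field) graded_complex \<Rightarrow> (nat \<Rightarrow> ('v, 'k) mpoly) \<Rightarrow> ('v, 'k) mpoly" where
  "aug_map F f = (\<Sum>b < rk F 0. aug F b * f b)"

definition bd_map ::
    "('v, 'k::field) graded_complex \<Rightarrow> nat \<Rightarrow>
     (nat \<Rightarrow> ('v, 'k) mpoly) \<Rightarrow> nat \<Rightarrow> ('v, 'k) mpoly" where
  "bd_map F i = mat_map (rk F i) (rk F (Suc i)) (bd F i)"

text \<open>
  The two homogeneity conditions say that all maps preserve degrees; the remaining ones say that
  \<open>\<dots> \<rightarrow> F\<^sub>1 \<rightarrow> F\<^sub>0 \<rightarrow> I \<rightarrow> 0\<close> is exact.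
\<close>

definition graded_free_resolution ::
    "('v, 'k::field) mpoly set \<Rightarrow> ('v, 'k) graded_complex \<Rightarrow> bool" where
  "graded_free_resolution I F \<longleftrightarrow>
     (\<forall>b < rk F 0. homogeneous (shift F 0 b) (aug F b)) \<and>
     (\<forall>i. \<forall>a < rk F i. \<forall>b < rk F (Suc i).
        homogeneous (shift F (Suc i) b - shift F i a) (bd F i a b)) \<and>
     aug_map F ` free_mod (rk F 0) = I \<and>
     {f \<in> free_mod (rk F 0). aug_map F f = 0} = bd_map F 0 ` free_mod (rk F 1) \<and>
     (\<forall>i. {f \<in> free_mod (rk F (Suc i)). bd_map F i f = 0} =
          bd_map F (Suc i) ` free_mod (rk F (Suc (Suc i))))"


section \<open>Tor and graded Betti numbers\<close>

text \<open>
  Tensoring with \<open>k = R/(x\<^sub>1, \<dots>, x\<^sub>m)\<close> turns \<open>F\<^sub>i\<close> into the graded vector space with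
  basis vectors in degrees \<open>shift i b\<close>, \<open>b < rk i\<close>, and replaces every matrix entry by its
  residue class, i.e. by its constant coefficient.
\<close>

definition tensor_part :: "('v, 'k::field) graded_complex \<Rightarrow> nat \<Rightarrow> int \<Rightarrow> (nat \<Rightarrow> 'k) set" where
  "tensor_part F i j = {c \<in> free_mod (rk F i). \<forall>b < rk F i. shift F i b \<noteq> j \<longrightarrow> c b = 0}"

definition tensor_bd ::
    "('v, 'k::field) graded_complex \<Rightarrow> nat \<Rightarrow> (nat \<Rightarrow> 'k) \<Rightarrow> nat \<Rightarrow> 'k" where
  "tensor_bd F i =
     mat_map (rk F i) (rk F (Suc i)) (\<lambda>a b. Poly_Mapping.lookup (bd F i a b) 0)"

definition tor_cycles :: "('v, 'k::field) graded_complex \<Rightarrow> nat \<Rightarrow> int \<Rightarrow> (nat \<Rightarrow> 'k) set" where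
  "tor_cycles F i j = {c \<in> tensor_part F i j. \<forall>h. i = Suc h \<longrightarrow> tensor_bd F h c = 0}"

definition tor_boundaries :: "('v, 'k::field) graded_complex \<Rightarrow> nat \<Rightarrow> int \<Rightarrow> (nat \<Rightarrow> 'k) set" where
  "tor_boundaries F i j = tensor_bd F i ` tensor_part F (Suc i) j"

definition fun_scale :: "'k::field \<Rightarrow> (nat \<Rightarrow> 'k) \<Rightarrow> nat \<Rightarrow> 'k" where
  "fun_scale a c = (\<lambda>b. a * c b)"

lemma vector_space_fun_scale: "vector_space (fun_scale :: 'k::field \<Rightarrow> _)"
  by unfold_locales (simp_all add: fun_scale_def fun_eq_iff algebra_simps)

text \<open>
  The dimension of cycles modulo boundaries in degree \<open>j\<close>. For a resolution the boundaries are a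
  subspace of the finite-dimensional space of cycles, so the subtraction is not truncated.
\<close>

definition tor_dim :: "('v, 'k::field) graded_complex \<Rightarrow> nat \<Rightarrow> int \<Rightarrow> nat" where
  "tor_dim F i j =
     vector_space.dim fun_scale (tor_cycles F i j) -
     vector_space.dim fun_scale (tor_boundaries F i j)"

text \<open>
  \<open>\<beta>\<^sub>i\<^sub>,\<^sub>j(I)\<close> is the dimension of \<open>Tor\<^sub>i(I,k)\<^sub>j\<close>, computed from some graded free resolution of
  the homogeneous ideal \<open>I\<close> of a polynomial ring in finitely many variables (one exists, and the
  result does not depend on it), with the convention for \<open>i = -1\<close>.
\<close>

definition graded_betti :: "('v::finite, 'k::field) mpoly set \<Rightarrow> int \<Rightarrow> int \<Rightarrow> nat" where
  "graded_betti I i j =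
     (if i = -1 then (if j = 0 then 1 else 0)
      else if i < -1 then 0
      else tor_dim (SOME F. graded_free_resolution I F) (nat i) j)"

end

theory Submission
  imports Defs
begin

text \<open>Instead of an ideal \<open>I\<close>, resolve \<open>R/I\<close>, so that \<open>\<beta>\<^sub>i\<^sub>-\<^sub>1(I)\<close> becomes
  \<open>dim Tor\<^sub>i(R/I, k)\<close> and the convention for \<open>i = -1\<close> becomes \<open>Tor\<^sub>0(R/I, k) = k\<close>. Any two graded
  resolutions of \<open>R/I\<close> have the same Tor, by lifting the identity and a null homotopy.

  If a monomial \<open>x\<^sup>a\<close> is added to \<open>I\<close>, a cone over a lift of the multiplication
  \<open>x\<^sup>a: R/(I : x\<^sup>a) \<rightarrow> R/I\<close> resolves \<open>R/(I + (x\<^sup>a))\<close>. By induction on the number of generators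
  every finitely generated monomial ideal has a resolution. If the lift is divisible by a variable
  it vanishes after tensoring with \<open>k\<close>, hence
  \<open>\<beta>\<^sub>i(I + (x\<^sup>a)) = \<beta>\<^sub>i(I) + \<beta>\<^sub>i\<^sub>-\<^sub>1(I : x\<^sup>a)\<close>, with the internal degree of the last term
  shifted by \<open>|a|\<close>.

  Adding the leaf \<open>uv\<close> to \<open>\<I>(T)\<close> is of this kind, because \<open>u\<close> does not occur in \<open>\<I>(T)\<close>; the
  colon ideal is \<open>\<I>(H) + (v\<^sub>1, \<dots>, v\<^sub>n\<^sub>-\<^sub>1)\<close>. Adding the variables \<open>v\<^sub>l\<close> to \<open>\<I>(H)\<close> one at a
  time is again of this kind, with colon ideal the ideal itself, and Pascal's rule yields the
  binomial sum.\<close>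

section \<open>Linear algebra: dimension counts for kernels, images and subquotients\<close>

context vector_space_pair
begin

text \<open>By \<open>ker\<close>, a vector of \<open>span A2\<close> that is sent into
  \<open>span C\<close> lies in \<open>span A1\<close>. So \<open>f\<close> is injective on the
  complement spanned by \<open>A2 - A1\<close>, even modulo \<open>span C\<close>. With
  \<open>C\<close> a basis of boundaries this compares homology; with \<open>C = {}\<close> it
  yields rank-nullity.\<close>

lemma independent_image_modulo:
  assumes lin: "Vector_Spaces.linear s1 s2 f"
    and A: "A1 \<subseteq> A2" "vs1.independent A2" "finite A2"
    and C: "vs2.independent C" "finite C"
    and ker: "\<And>z. z \<in> vs1.span A2 \<Longrightarrow> f z \<in> vs2.span C \<Longrightarrow> z \<in> vs1.span A1"
  shows "vs2.independent (f ` (A2 - A1) \<union> C) \<and>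
         card (f ` (A2 - A1) \<union> C) = card (A2 - A1) + card C"
proof -
  interpret Vector_Spaces.linear s1 s2 f by (rule lin)
  have "vs2.independent (f ` Y \<union> C) \<and> card (f ` Y \<union> C) = card Y + card C"
    if "finite Y" "Y \<subseteq> A2 - A1" for Y
    using that
  proof (induction Y)
    case empty
    then show ?case using C by simp
  next
    case (insert x Y)
    \<comment> \<open>A relation would put \<open>x - y\<close> into \<open>span A1\<close> for some
      \<open>y\<close> in \<open>span Y\<close>, hence \<open>x\<close> into the span of the other
      elements of the independent set \<open>A2\<close>.\<close>
    have "f x \<notin> vs2.span (f ` Y \<union> C)"
    proof
      assume "f x \<in> vs2.span (f ` Y \<union> C)"
      then obtain p q where pq: "f x = p + q" "p \<in> vs2.span (f ` Y)" "q \<in> vs2.span C"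
        unfolding vs2.span_Un by auto
      from pq(2) obtain y where y: "y \<in> vs1.span Y" "p = f y"
        using linear_span_image[OF lin, of Y] by auto
      have "f (x - y) \<in> vs2.span C"
        using pq y by (simp add: diff)
      moreover have yA: "y \<in> vs1.span A2"
        using y insert.prems vs1.span_mono[of Y A2] by blast
      ultimately have "x - y \<in> vs1.span A1"
        using insert.prems by (intro ker vs1.span_diff) (auto intro: vs1.span_base)
      then have "x - y \<in> vs1.span (A2 - {x})"
        using insert.prems A vs1.span_mono[of A1 "A2 - {x}"] by blast
      moreover have "y \<in> vs1.span (A2 - {x})"
        using y insert vs1.span_mono[of Y "A2 - {x}"] by blast
      ultimately have "x - y + y \<in> vs1.span (A2 - {x})"
        by (rule vs1.span_add)
      then show False
        using A(2) insert.prems by (auto simp: vs1.dependent_def)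
    qed
    moreover from this have "f x \<notin> f ` Y \<union> C"
      using vs2.span_base[of "f x" "f ` Y \<union> C"] by blast
    moreover have "vs2.independent (f ` Y \<union> C)" "card (f ` Y \<union> C) = card Y + card C"
      using insert.IH insert.prems by blast+
    ultimately have "vs2.independent (insert (f x) (f ` Y \<union> C))"
        "card (insert (f x) (f ` Y \<union> C)) = Suc (card Y + card C)"
      using insert.hyps(1) C(2) by (simp_all only: vs2.independent_insert card_insert_disjoint
          finite_Un finite_imageI if_False simp_thms)
    then show ?case
      using insert.hyps by (simp only: image_insert Un_insert_left card_insert_disjoint) simp
  qed
  from this[of "A2 - A1"] A show ?thesis by auto
qed

text \<open>Everything in \<open>Z\<close> that \<open>f\<close> sends into \<open>B'\<close> lies
  in \<open>B\<close>, so a complement of \<open>B\<close> in \<open>Z\<close> embeds into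
  \<open>Z'/B'\<close>. The inequality between the two quotient dimensions is written with sums to
  avoid truncated subtraction.\<close>

lemma dim_quotient_le:
  assumes lin: "Vector_Spaces.linear s1 s2 f"
    and fin: "finite S" "Z \<subseteq> vs1.span S" "finite S'" "Z' \<subseteq> vs2.span S'"
    and sub: "vs1.subspace Z" "vs2.subspace B'" "B \<subseteq> Z" "B' \<subseteq> Z'"
    and maps: "f ` Z \<subseteq> Z'" "\<And>z. z \<in> Z \<Longrightarrow> f z \<in> B' \<Longrightarrow> z \<in> B"
  shows "vs1.dim Z + vs2.dim B' \<le> vs2.dim Z' + vs1.dim B"
proof -
  obtain A1 where A1: "A1 \<subseteq> B" "vs1.independent A1" "B \<subseteq> vs1.span A1" "card A1 = vs1.dim B"
    using vs1.basis_exists by blast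
  obtain A2 where A2: "A1 \<subseteq> A2" "A2 \<subseteq> Z" "vs1.independent A2" "Z \<subseteq> vs1.span A2"
    using vs1.maximal_independent_subset_extend[of A1 Z] A1 sub by blast
  have finA2: "finite A2"
    using vs1.independent_span_bound[OF fin(1) A2(3)] A2(2) fin(2) by blast
  have dimZ: "vs1.dim Z = card A2"
    using A2 by (intro vs1.dim_unique) auto
  obtain C where C: "C \<subseteq> B'" "vs2.independent C" "B' \<subseteq> vs2.span C" "card C = vs2.dim B'"
    using vs2.basis_exists by blast
  have finC: "finite C"
    using vs2.independent_span_bound[OF fin(3) C(2)] C(1) sub fin(4) by blast
  have spanA2: "vs1.span A2 = Z"
    using A2 sub vs1.span_subspace by blast
  have spanC: "vs2.span C = B'"
    using C sub vs2.span_subspace by blast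
  let ?X = "f ` (A2 - A1) \<union> C"
  have X: "vs2.independent ?X" "card ?X = card (A2 - A1) + card C"
    using independent_image_modulo[OF lin A2(1,3) finA2 C(2) finC] maps(2) A1(3) spanA2 spanC
    by blast+
  have "?X \<subseteq> Z'"
    using A2 C sub maps by blast
  then obtain D where D: "?X \<subseteq> D" "D \<subseteq> Z'" "vs2.independent D" "Z' \<subseteq> vs2.span D"
    using vs2.maximal_independent_subset_extend[of ?X Z'] X by blast
  have "finite D"
    using vs2.independent_span_bound[OF fin(3) D(3)] D(2) fin(4) by blast
  then have "card ?X \<le> card D"
    using D by (simp add: card_mono)
  moreover have "vs2.dim Z' = card D"
    using D by (intro vs2.dim_unique) auto
  moreover have "card (A2 - A1) = card A2 - card A1" "card A1 \<le> card A2"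
    using A2 finA2 by (auto simp: card_Diff_subset finite_subset card_mono)
  ultimately show ?thesis
    using X C A1 dimZ by linarith
qed

text \<open>Rank-nullity for \<open>f\<close> restricted to \<open>Z\<close>: a basis of the kernel
  is extended to one of \<open>Z\<close>, and the added vectors map to a basis of the image.\<close>

lemma dim_kernel_plus_dim_image:
  assumes lin: "Vector_Spaces.linear s1 s2 f" and fin: "finite S" "Z \<subseteq> vs1.span S" and sub: "vs1.subspace Z"
  shows "vs1.dim Z = vs1.dim {z \<in> Z. f z = 0} + vs2.dim (f ` Z)"
proof -
  interpret Vector_Spaces.linear s1 s2 f by (rule lin)
  let ?B = "{z \<in> Z. f z = 0}"
  obtain A1 where A1: "A1 \<subseteq> ?B" "vs1.independent A1" "?B \<subseteq> vs1.span A1" "card A1 = vs1.dim ?B"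
    using vs1.basis_exists by blast
  obtain A2 where A2: "A1 \<subseteq> A2" "A2 \<subseteq> Z" "vs1.independent A2" "Z \<subseteq> vs1.span A2"
    using vs1.maximal_independent_subset_extend[of A1 Z] A1 by blast
  have finA2: "finite A2"
    using vs1.independent_span_bound[OF fin(1) A2(3)] A2(2) fin(2) by blast
  have dimZ: "vs1.dim Z = card A2"
    using A2 by (intro vs1.dim_unique) auto
  have spanA2: "vs1.span A2 = Z"
    using A2 sub vs1.span_subspace by blast
  have X: "vs2.independent (f ` (A2 - A1) \<union> {})"
      "card (f ` (A2 - A1) \<union> {}) = card (A2 - A1) + card ({} :: 'c set)"
    using independent_image_modulo[OF lin A2(1,3) finA2 vs2.independent_empty]
      A1(3) spanA2 by auto
  have "f ` Z = vs2.span (f ` A2)"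
    using spanA2 linear_span_image[OF lin, of A2] by simp
  also have "\<dots> \<subseteq> vs2.span (f ` (A2 - A1))"
  proof (rule vs2.span_minimal)
    show "f ` A2 \<subseteq> vs2.span (f ` (A2 - A1))"
    proof
      fix y assume "y \<in> f ` A2"
      then obtain x where "x \<in> A2" "y = f x" by blast
      then show "y \<in> vs2.span (f ` (A2 - A1))"
        using A1(1) by (cases "f x = 0") (auto intro!: vs2.span_base vs2.span_zero)
    qed
  qed auto
  finally have "vs2.dim (f ` Z) = card (f ` (A2 - A1))"
    using A2 X by (intro vs2.dim_unique) auto
  moreover have "card (A2 - A1) = card A2 - card A1" "card A1 \<le> card A2"
    using A2 finA2 by (auto simp: card_Diff_subset finite_subset card_mono)
  ultimately show ?thesis
    using X A1 dimZ by simp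
qed

end

interpretation fun_space: vector_space "fun_scale :: 'k::field \<Rightarrow> _"
  by (rule vector_space_fun_scale)

interpretation fun_pair: vector_space_pair "fun_scale :: 'k::field \<Rightarrow> _" "fun_scale :: 'k \<Rightarrow> _"
  ..

lemma sum_fun_apply: "(\<Sum>a\<in>A. f a) x = (\<Sum>a\<in>A. f a x)" for f :: "'a \<Rightarrow> 'b \<Rightarrow> 'c::comm_monoid_add"
  by (induction A rule: infinite_finite_induct) auto

lemma free_mod_finite_span: "\<exists>S. finite S \<and> (free_mod r :: (nat \<Rightarrow> 'k::field) set) \<subseteq> fun_space.span S"
proof -
  let ?e = "\<lambda>b c. if c = b then 1 else (0::'k)"
  have "f \<in> fun_space.span (?e ` {..<r})" if "f \<in> free_mod r" for f :: "nat \<Rightarrow> 'k"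
  proof -
    have "f = (\<Sum>b<r. fun_scale (f b) (?e b))"
      using that by (auto simp: fun_eq_iff fun_scale_def free_mod_def sum_fun_apply if_distrib cong: if_cong)
    then show ?thesis
      by (metis (no_types, lifting) fun_space.span_sum fun_space.span_scale fun_space.span_base imageI)
  qed
  then show ?thesis by blast
qed

section \<open>Matrices and vectors\<close>

lemma mat_map_free_mod [simp]: "mat_map r s A f \<in> free_mod r"
  by (simp add: mat_map_def free_mod_def)

lemma mat_map_add: "mat_map r s A (f + g) = mat_map r s A f + mat_map r s A g"
  by (auto simp: mat_map_def fun_eq_iff distrib_left sum.distrib)

lemma mat_map_diff: "mat_map r s A (f - g) = mat_map r s A f - mat_map r s A g"
  by (auto simp: mat_map_def fun_eq_iff right_diff_distrib sum_subtractf)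

lemma mat_map_minus: "mat_map r s A (- f) = - mat_map r s A f"
  by (auto simp: mat_map_def fun_eq_iff sum_negf)

lemma mat_map_zero [simp]: "mat_map r s A 0 = 0"
  by (auto simp: mat_map_def fun_eq_iff)

lemma mat_map_fun_scale: "mat_map r s A (fun_scale c f) = fun_scale c (mat_map r s A f)"
  by (auto simp: mat_map_def fun_eq_iff fun_scale_def sum_distrib_left mult_ac)

lemma linear_mat_map: "Vector_Spaces.linear fun_scale fun_scale (mat_map r s A)"
  by unfold_locales
    (simp_all add: mat_map_add mat_map_fun_scale, simp_all add: fun_scale_def fun_eq_iff algebra_simps)

lemma free_mod_simps [simp]:
  "0 \<in> free_mod r" "f \<in> free_mod r \<Longrightarrow> g \<in> free_mod r \<Longrightarrow> f + g \<in> free_mod r"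
  "f \<in> free_mod r \<Longrightarrow> g \<in> free_mod r \<Longrightarrow> f - g \<in> free_mod r"
  "f \<in> free_mod r \<Longrightarrow> - f \<in> free_mod r"
  for f g :: "nat \<Rightarrow> 'a::ab_group_add"
  by (auto simp: free_mod_def)

lemma mat_map_cong:
  assumes "\<And>a b. a < r \<Longrightarrow> b < s \<Longrightarrow> A a b = B a b" "\<And>b. b < s \<Longrightarrow> f b = g b"
  shows "mat_map r s A f = mat_map r s B g"
  using assms by (auto simp: mat_map_def fun_eq_iff intro!: sum.cong)

text \<open>A matrix reads only the first entries of its argument, so identities and images can be
  stated for arbitrary functions. The cut-off appears only where membership in
  \<open>free_mod\<close> matters.\<close>

definition truncate :: "nat \<Rightarrow> (nat \<Rightarrow> 'a::zero) \<Rightarrow> nat \<Rightarrow> 'a" where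
  "truncate r f = (\<lambda>b. if b < r then f b else 0)"

lemma truncate_free_mod [simp]: "truncate r f \<in> free_mod r"
  by (simp add: truncate_def free_mod_def)

lemma truncate_id: "f \<in> free_mod r \<Longrightarrow> truncate r f = f"
  by (auto simp: truncate_def free_mod_def fun_eq_iff)

lemma mat_map_truncate [simp]: "mat_map r s A (truncate s f) = mat_map r s A f"
  by (rule mat_map_cong) (auto simp: truncate_def)

lemma image_mat_map: "mat_map r s A ` free_mod s = Set.range (mat_map r s A)"
proof -
  have "mat_map r s A f \<in> mat_map r s A ` free_mod s" for f
    by (metis mat_map_truncate truncate_free_mod imageI)
  then show ?thesis by blast
qed

lemma mat_map_identity: "mat_map r r (\<lambda>a b. of_bool (a = b)) f = truncate r f"
  by (auto simp: mat_map_def truncate_def fun_eq_iff)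

lemma mat_map_minus_matrix: "mat_map r s (\<lambda>a b. A a b - B a b) f = mat_map r s A f - mat_map r s B f"
  by (auto simp: mat_map_def fun_eq_iff left_diff_distrib sum_subtractf)

definition mat_mult :: "nat \<Rightarrow> (nat \<Rightarrow> nat \<Rightarrow> 'a) \<Rightarrow> (nat \<Rightarrow> nat \<Rightarrow> 'a) \<Rightarrow> nat \<Rightarrow> nat \<Rightarrow> 'a::comm_ring_1" where
  "mat_mult s A B = (\<lambda>a b. \<Sum>c<s. A a c * B c b)"

lemma mat_map_mat_mult: "mat_map r t (mat_mult s A B) f = mat_map r s A (mat_map s t B f)"
proof -
  have "(\<Sum>b<t. (\<Sum>c<s. A a c * B c b) * f b) = (\<Sum>c<s. A a c * (\<Sum>b<t. B c b * f b))" for a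
    unfolding sum_distrib_left sum_distrib_right by (subst sum.swap) (simp add: mult_ac)
  then show ?thesis
    by (auto simp: mat_map_def mat_mult_def fun_eq_iff)
qed

section \<open>Direct sums and block triangular matrices\<close>

definition join :: "nat \<Rightarrow> (nat \<Rightarrow> 'a) \<Rightarrow> (nat \<Rightarrow> 'a) \<Rightarrow> nat \<Rightarrow> 'a" where
  "join r f g = (\<lambda>b. if b < r then f b else g (b - r))"

text \<open>The matrix with block rows \<open>(A, B)\<close> and \<open>(0, -C)\<close>. This is the
  shape of a cone differential; the sign makes consecutive ones compose to zero when the blocks
  \<open>B\<close> form a chain map.\<close>

definition block :: "nat \<Rightarrow> nat \<Rightarrow> (nat \<Rightarrow> nat \<Rightarrow> 'a) \<Rightarrow> (nat \<Rightarrow> nat \<Rightarrow> 'a) \<Rightarrow>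
    (nat \<Rightarrow> nat \<Rightarrow> 'a) \<Rightarrow> nat \<Rightarrow> nat \<Rightarrow> 'a::comm_ring_1" where
  "block r s A B C = (\<lambda>a b. if a < r then (if b < s then A a b else B a (b - s))
     else (if b < s then 0 else - C (a - r) (b - s)))"

lemma join_free_mod: "g \<in> free_mod r' \<Longrightarrow> join r f g \<in> free_mod (r + r')"
  by (auto simp: join_def free_mod_def)

lemma free_mod_joinE:
  assumes "h \<in> free_mod (r + r')"
  obtains f g where "h = join r f g" "f \<in> free_mod r" "g \<in> free_mod r'"
proof
  show "h = join r (truncate r h) (\<lambda>b. h (b + r))"
    by (auto simp: join_def truncate_def fun_eq_iff)
  show "(\<lambda>b. h (b + r)) \<in> free_mod r'"
    using assms by (simp add: free_mod_def add.commute)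
qed simp

lemma join_eq_iff:
  assumes "f \<in> free_mod r" "f' \<in> free_mod r"
  shows "join r f g = join r f' g' \<longleftrightarrow> f = f' \<and> g = g'"
proof
  assume eq: "join r f g = join r f' g'"
  have "f b = f' b" for b
    using fun_cong[OF eq, of b] assms by (cases "b < r") (auto simp: join_def free_mod_def)
  moreover have "g b = g' b" for b
    using fun_cong[OF eq, of "b + r"] by (simp add: join_def)
  ultimately show "f = f' \<and> g = g'" by auto
qed auto

lemma join_zero [simp]: "join r 0 0 = 0"
  by (auto simp: join_def)

lemma mat_map_block:
  "mat_map (r + r') (s + s') (block r s A B C) (join s f g) =
     join r (mat_map r s A f + mat_map r s' B g) (- mat_map r' s' C g)"
proof
  have split: "(\<Sum>b<s + s'. h b) = (\<Sum>b<s. h b) + (\<Sum>b<s'. h (b + s))" for h :: "nat \<Rightarrow> 'a"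
    by (induction s') (auto simp: add_ac)
  fix a
  show "mat_map (r + r') (s + s') (block r s A B C) (join s f g) a =
     join r (mat_map r s A f + mat_map r s' B g) (- mat_map r' s' C g) a"
    by (auto simp: mat_map_def block_def join_def split sum_negf)
qed

lemma dim_join:
  fixes A B :: "(nat \<Rightarrow> 'k::field) set"
  assumes A: "fun_space.subspace A" "A \<subseteq> free_mod r"
    and B: "fun_space.subspace B" "B \<subseteq> free_mod r'"
  shows "fun_space.dim {join r f g | f g. f \<in> A \<and> g \<in> B} = fun_space.dim A + fun_space.dim B"
proof -
  let ?J = "{join r f g | f g. f \<in> A \<and> g \<in> B}"
  let ?i = "\<lambda>f. join r f 0" and ?p = "\<lambda>(h :: nat \<Rightarrow> 'k) b. h (b + r)"
  have add: "join r f g + join r f' g' = join r (f + f') (g + g')" for f g f' g' :: "nat \<Rightarrow> 'k"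
    by (auto simp: join_def fun_eq_iff)
  have scale: "fun_scale c (join r f g) = join r (fun_scale c f) (fun_scale c g)" for c and f g :: "nat \<Rightarrow> 'k"
    by (auto simp: join_def fun_eq_iff fun_scale_def)
  have lin_i: "Vector_Spaces.linear fun_scale fun_scale ?i"
    by unfold_locales (auto simp: join_def fun_eq_iff fun_scale_def algebra_simps)
  have lin_p: "Vector_Spaces.linear fun_scale fun_scale ?p"
    by unfold_locales (auto simp: fun_eq_iff fun_scale_def algebra_simps)
  have p_join: "?p (join r f g) = g" for f g
    by (auto simp: join_def)
  have J: "fun_space.subspace ?J"
    unfolding fun_space.subspace_def
  proof (intro conjI ballI allI)
    show "0 \<in> ?J"
      using A B by (force simp: fun_space.subspace_def intro!: exI[of _ 0])
  next
    fix x y assume "x \<in> ?J" "y \<in> ?J"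
    then show "x + y \<in> ?J"
      using A B by (auto simp: add) (metis fun_space.subspace_add)
  next
    fix c x assume "x \<in> ?J"
    then show "fun_scale c x \<in> ?J"
      using A B by (auto simp: scale) (metis fun_space.subspace_scale)
  qed
  obtain S where S: "finite S" "(free_mod (r + r') :: (nat \<Rightarrow> 'k) set) \<subseteq> fun_space.span S"
    using free_mod_finite_span by blast
  obtain S' where S': "finite S'" "(free_mod r :: (nat \<Rightarrow> 'k) set) \<subseteq> fun_space.span S'"
    using free_mod_finite_span by blast
  have "?J \<subseteq> fun_space.span S"
    using S(2) B(2) join_free_mod by blast
  then have "fun_space.dim ?J = fun_space.dim {z \<in> ?J. ?p z = 0} + fun_space.dim (?p ` ?J)"
    by (intro fun_pair.dim_kernel_plus_dim_image[OF lin_p S(1) _ J])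
  also have "?p ` ?J = B"
    using A(1) by (force simp: p_join image_iff intro: fun_space.subspace_0)
  also have "{z \<in> ?J. ?p z = 0} = ?i ` A"
    using B(1) by (auto simp: p_join intro: fun_space.subspace_0)
  also have "fun_space.dim A = fun_space.dim {z \<in> A. ?i z = 0} + fun_space.dim (?i ` A)"
    using A S' by (intro fun_pair.dim_kernel_plus_dim_image[OF lin_i S'(1)]) auto
  \<comment> \<open>\<open>join r\<close> forgets the entries of its first argument from
    \<open>r\<close> on, so injectivity of \<open>?i\<close> rests on \<open>A\<close> lying in
    \<open>free_mod r\<close>.\<close>
  moreover have "{z \<in> A. ?i z = 0} = {0}"
    using A join_eq_iff[of _ r 0 0 0] by (auto intro: fun_space.subspace_0)
  moreover have "fun_space.dim {0 :: nat \<Rightarrow> 'k} = 0"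
    using fun_space.dim_unique[of "{}" "{0}" 0] by (simp add: fun_space.independent_empty)
  ultimately show ?thesis
    by simp
qed

section \<open>Homogeneous polynomials and matrices\<close>

lemma monomial_degree_add: "monomial_degree (a + b) = monomial_degree a + monomial_degree b"
  unfolding monomial_degree_def by (rule setsum_keys_plus_distrib) auto

lemma monomial_degree_zero [simp]: "monomial_degree 0 = 0"
  by (simp add: monomial_degree_def)

lemma monomial_degree_eq_0_iff [simp]: "monomial_degree m = 0 \<longleftrightarrow> m = 0"
  by (auto simp: monomial_degree_def in_keys_iff intro: poly_mapping_eqI)

lemma monomial_degree_single [simp]: "monomial_degree (Poly_Mapping.single x k) = k"
  by (simp add: monomial_degree_def)

lemma exponent_add_eq_0_iff: "a + b = 0 \<longleftrightarrow> a = 0 \<and> b = 0" for a b :: "'v \<Rightarrow>\<^sub>0 nat"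
  by (metis add_eq_0_iff_both_eq_0 monomial_degree_add monomial_degree_eq_0_iff)

text \<open>Exponents are natural numbers, so \<open>0 = l + m\<close> forces
  \<open>l = m = 0\<close> and only one term of the convolution survives. Taking constant
  coefficients is thus the ring map onto the residue field.\<close>

lemma constant_coeff_mult:
  "Poly_Mapping.lookup (p * q) 0 = Poly_Mapping.lookup p 0 * Poly_Mapping.lookup q 0"
  for p q :: "('v, 'k::field) mpoly"
proof -
  have "(\<Sum>m. Poly_Mapping.lookup q m when 0 = l + m) = (Poly_Mapping.lookup q 0 when l = 0)" for l
  proof -
    have "(\<lambda>m. Poly_Mapping.lookup q m when 0 = l + m) =
        (\<lambda>m. (Poly_Mapping.lookup q m when l = 0) when m = 0)"
      by (auto simp: fun_eq_iff when_def exponent_add_eq_0_iff dest: sym)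
    then show ?thesis by (simp only: Sum_any_when_equal)
  qed
  then show ?thesis
    by (simp add: lookup_mult mult_when)
qed

lemma homogeneous_zero [simp]: "homogeneous d 0"
  by (simp add: homogeneous_def)

lemma homogeneous_one [simp]: "homogeneous 0 1"
  by (simp add: homogeneous_def)

lemma homogeneous_single [simp]: "homogeneous (int (monomial_degree m)) (Poly_Mapping.single m c)"
  by (simp add: homogeneous_def)

lemma homogeneous_add: "homogeneous d p \<Longrightarrow> homogeneous d q \<Longrightarrow> homogeneous d (p + q)"
  using keys_add[of p q] by (auto simp: homogeneous_def)

lemma homogeneous_minus: "homogeneous d p \<Longrightarrow> homogeneous d (- p)"
  by (auto simp: homogeneous_def in_keys_iff)

lemma homogeneous_diff: "homogeneous d p \<Longrightarrow> homogeneous d q \<Longrightarrow> homogeneous d (p - q)"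
  using homogeneous_add[of d p "- q"] homogeneous_minus by auto

lemma homogeneous_mult: "homogeneous d p \<Longrightarrow> homogeneous e q \<Longrightarrow> homogeneous (d + e) (p * q)"
  using keys_mult[of p q] by (fastforce simp: homogeneous_def monomial_degree_add)

lemma homogeneous_sum: "(\<And>x. x \<in> A \<Longrightarrow> homogeneous d (f x)) \<Longrightarrow> homogeneous d (sum f A)"
  by (induction A rule: infinite_finite_induct) (auto intro: homogeneous_add)

lemma homogeneous_constant_coeff: "homogeneous d p \<Longrightarrow> d \<noteq> 0 \<Longrightarrow> Poly_Mapping.lookup p 0 = 0"
  by (force simp: homogeneous_def in_keys_iff)

text \<open>A general predicate on exponents serves two purposes: extracting homogeneous components,
  and separating the terms inside a monomial ideal from those outside.\<close>

definition terms_part :: "(('v \<Rightarrow>\<^sub>0 nat) \<Rightarrow> bool) \<Rightarrow> ('v, 'k::field) mpoly \<Rightarrow> ('v, 'k) mpoly" where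
  "terms_part P = Poly_Mapping.mapp (\<lambda>m c. c when P m)"

lemma lookup_terms_part: "Poly_Mapping.lookup (terms_part P p) m = (Poly_Mapping.lookup p m when P m)"
  by (auto simp: terms_part_def lookup_mapp when_def in_keys_iff)

lemma keys_terms_part: "Poly_Mapping.keys (terms_part P p) = {m \<in> Poly_Mapping.keys p. P m}"
  by (auto simp: in_keys_iff lookup_terms_part)

lemma terms_part_add: "terms_part P (p + q) = terms_part P p + terms_part P q"
  by (rule poly_mapping_eqI) (simp add: lookup_terms_part lookup_add when_def)

lemma terms_part_sum: "terms_part P (sum f A) = (\<Sum>x\<in>A. terms_part P (f x))"
  by (rule poly_mapping_eqI) (simp add: lookup_terms_part lookup_sum when_def)

lemma terms_part_compl: "p = terms_part P p + terms_part (\<lambda>m. \<not> P m) p"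
  by (rule poly_mapping_eqI) (simp add: lookup_terms_part lookup_add when_def)

lemma terms_part_id: "(\<And>m. m \<in> Poly_Mapping.keys p \<Longrightarrow> P m) \<Longrightarrow> terms_part P p = p"
  by (rule poly_mapping_eqI) (auto simp: lookup_terms_part when_def in_keys_iff)

lemma terms_part_eq_0: "(\<And>m. m \<in> Poly_Mapping.keys p \<Longrightarrow> \<not> P m) \<Longrightarrow> terms_part P p = 0"
  by (rule poly_mapping_eqI) (auto simp: lookup_terms_part when_def in_keys_iff)

abbreviation homogeneous_part :: "int \<Rightarrow> ('v, 'k::field) mpoly \<Rightarrow> ('v, 'k) mpoly" where
  "homogeneous_part d \<equiv> terms_part (\<lambda>m. int (monomial_degree m) = d)"

lemma homogeneous_homogeneous_part [simp]: "homogeneous d (homogeneous_part d p)"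
  by (simp add: homogeneous_def keys_terms_part)

lemma homogeneous_part_id: "homogeneous d p \<Longrightarrow> homogeneous_part d p = p"
  by (rule terms_part_id) (simp add: homogeneous_def)

text \<open>The components of \<open>q\<close> in degrees other than \<open>d - e\<close> contribute
  nothing in degree \<open>d\<close> after multiplication by a form of degree
  \<open>e\<close>.\<close>

lemma homogeneous_part_mult:
  assumes "homogeneous e p"
  shows "homogeneous_part d (p * q) = p * homogeneous_part (d - e) q"
proof -
  define q' where "q' = terms_part (\<lambda>m. int (monomial_degree m) \<noteq> d - e) q"
  have "homogeneous_part d (p * q) =
      homogeneous_part d (p * homogeneous_part (d - e) q) + homogeneous_part d (p * q')"
    unfolding q'_def by (subst terms_part_compl[of q "\<lambda>m. int (monomial_degree m) = d - e"])
      (simp add: distrib_left terms_part_add)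
  also have "homogeneous_part d (p * q') = 0"
  proof (rule terms_part_eq_0)
    fix m assume "m \<in> Poly_Mapping.keys (p * q')"
    then obtain a b where "m = a + b" "a \<in> Poly_Mapping.keys p" "b \<in> Poly_Mapping.keys q'"
      using keys_mult[of p q'] by blast
    then show "int (monomial_degree m) \<noteq> d"
      using assms by (auto simp: q'_def keys_terms_part homogeneous_def monomial_degree_add)
  qed
  also have "homogeneous_part d (p * homogeneous_part (d - e) q) = p * homogeneous_part (d - e) q"
    using homogeneous_mult[OF assms homogeneous_homogeneous_part, of "d - e" q]
    by (intro homogeneous_part_id) simp
  finally show ?thesis by simp
qed

text \<open>A degree-preserving map from the sum of the \<open>R(-\<tau> b)\<close> to the sum of
  the \<open>R(-\<sigma> a)\<close>: generators sit in degrees \<open>\<tau> b\<close> and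
  \<open>\<sigma> a\<close>.\<close>

definition homogeneous_matrix :: "nat \<Rightarrow> nat \<Rightarrow> (nat \<Rightarrow> int) \<Rightarrow> (nat \<Rightarrow> int) \<Rightarrow>
    (nat \<Rightarrow> nat \<Rightarrow> ('v, 'k::field) mpoly) \<Rightarrow> bool" where
  "homogeneous_matrix r s \<sigma> \<tau> A \<longleftrightarrow> (\<forall>a<r. \<forall>b<s. homogeneous (\<tau> b - \<sigma> a) (A a b))"

lemma homogeneous_matrix_mat_mult:
  assumes "homogeneous_matrix r s \<sigma> \<tau> A" "homogeneous_matrix s t \<tau> \<upsilon> B"
  shows "homogeneous_matrix r t \<sigma> \<upsilon> (mat_mult s A B)"
  unfolding homogeneous_matrix_def
proof (intro allI impI)
  fix a b assume ab: "a < r" "b < t"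
  have "homogeneous (\<upsilon> b - \<sigma> a) (A a c * B c b)" if "c < s" for c
    using homogeneous_mult[of "\<tau> c - \<sigma> a" "A a c" "\<upsilon> b - \<tau> c" "B c b"] assms ab that
    by (simp add: homogeneous_matrix_def)
  then show "homogeneous (\<upsilon> b - \<sigma> a) (mat_mult s A B a b)"
    by (auto simp: mat_mult_def intro: homogeneous_sum)
qed

lemma homogeneous_matrix_diff:
  "homogeneous_matrix r s \<sigma> \<tau> A \<Longrightarrow> homogeneous_matrix r s \<sigma> \<tau> B \<Longrightarrow>
     homogeneous_matrix r s \<sigma> \<tau> (\<lambda>a b. A a b - B a b)"
  by (simp add: homogeneous_matrix_def homogeneous_diff)

lemma homogeneous_matrix_identity: "homogeneous_matrix r r \<sigma> \<sigma> (\<lambda>a b. of_bool (a = b))"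
  by (auto simp: homogeneous_matrix_def)

text \<open>A graded map commutes with taking the component of degree \<open>t\<close>. If the image
  of \<open>x\<close> is already homogeneous of degree \<open>t\<close>, the degree \<open>t\<close>
  component of \<open>x\<close> has the same image.\<close>

lemma homogeneous_preimage:
  assumes A: "homogeneous_matrix r s \<sigma> \<tau> A"
    and x: "\<And>a. a < r \<Longrightarrow> homogeneous (t - \<sigma> a) (mat_map r s A x a)"
  shows "mat_map r s A (\<lambda>b. homogeneous_part (t - \<tau> b) (x b)) = mat_map r s A x"
proof -
  have "(\<Sum>b<s. A a b * homogeneous_part (t - \<tau> b) (x b)) = (\<Sum>b<s. A a b * x b)" if a: "a < r" for a
  proof -
    have "A a b * homogeneous_part (t - \<tau> b) (x b) = homogeneous_part (t - \<sigma> a) (A a b * x b)"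
      if "b < s" for b
      using homogeneous_part_mult[of "\<tau> b - \<sigma> a" "A a b" "t - \<sigma> a" "x b"] A a that
      by (simp add: homogeneous_matrix_def)
    then have "(\<Sum>b<s. A a b * homogeneous_part (t - \<tau> b) (x b)) =
        homogeneous_part (t - \<sigma> a) (\<Sum>b<s. A a b * x b)"
      by (simp add: terms_part_sum)
    then show ?thesis
      using homogeneous_part_id[OF x[OF a]] a by (simp add: mat_map_def)
  qed
  then show ?thesis
    by (simp add: mat_map_def fun_eq_iff)
qed

text \<open>Free modules are projective, in the graded sense: each column of \<open>C\<close> is
  lifted separately through \<open>A\<close>, with a preimage that is homogeneous of the degree of
  that column.\<close>

lemma homogeneous_matrix_lift:
  assumes A: "homogeneous_matrix r s \<sigma> \<tau> A" and C: "homogeneous_matrix r n \<sigma> \<upsilon> C"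
    and im: "\<And>g. mat_map r n C g \<in> range (mat_map r s A)"
  obtains B where "homogeneous_matrix s n \<tau> \<upsilon> B"
    "\<And>g. mat_map r s A (mat_map s n B g) = mat_map r n C g"
proof -
  have "\<exists>x. (\<forall>c<s. homogeneous (\<upsilon> b - \<tau> c) (x c)) \<and> (\<forall>a<r. (\<Sum>c<s. A a c * x c) = C a b)"
    if b: "b < n" for b
  proof -
    have col: "mat_map r n C (\<lambda>c. of_bool (c = b)) a = C a b" if "a < r" for a
      using b that by (simp add: mat_map_def)
    obtain x0 where x0: "mat_map r n C (\<lambda>c. of_bool (c = b)) = mat_map r s A x0"
      using im by blast
    \<comment> \<open>The preimage \<open>x0\<close> need not be homogeneous; its component in the
      degree \<open>\<upsilon> b\<close> of the column is one that is.\<close>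
    define x where "x c = homogeneous_part (\<upsilon> b - \<tau> c) (x0 c)" for c
    have "mat_map r s A x = mat_map r s A x0"
      unfolding x_def using C b
      by (intro homogeneous_preimage[OF A]) (simp add: x0[symmetric] col homogeneous_matrix_def)
    then have "mat_map r s A x a = C a b" if "a < r" for a
      using col[OF that] x0 by simp
    then show ?thesis
      by (intro exI[of _ x]) (simp add: x_def mat_map_def)
  qed
  then obtain x where x: "\<And>b. b < n \<Longrightarrow> (\<forall>c<s. homogeneous (\<upsilon> b - \<tau> c) (x b c)) \<and>
      (\<forall>a<r. (\<Sum>c<s. A a c * x b c) = C a b)"
    by metis
  show thesis
  proof
    show "homogeneous_matrix s n \<tau> \<upsilon> (\<lambda>c b. x b c)"
      using x by (simp add: homogeneous_matrix_def)
    show "mat_map r s A (mat_map s n (\<lambda>c b. x b c) g) = mat_map r n C g" for g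
      unfolding mat_map_mat_mult[symmetric] using x
      by (intro mat_map_cong) (auto simp: mat_mult_def)
  qed
qed

text \<open>Reduction modulo the ideal of the variables, i.e. the passage from a free module to its
  tensor product with \<open>k\<close>.\<close>

definition residue_vector :: "(nat \<Rightarrow> ('v, 'k::field) mpoly) \<Rightarrow> nat \<Rightarrow> 'k" where
  "residue_vector g = (\<lambda>b. Poly_Mapping.lookup (g b) 0)"

abbreviation residue_map ::
    "nat \<Rightarrow> nat \<Rightarrow> (nat \<Rightarrow> nat \<Rightarrow> ('v, 'k::field) mpoly) \<Rightarrow> (nat \<Rightarrow> 'k) \<Rightarrow> nat \<Rightarrow> 'k" where
  "residue_map r s A \<equiv> mat_map r s (\<lambda>a b. Poly_Mapping.lookup (A a b) 0)"

lemma residue_vector_mat_map: "residue_vector (mat_map r s A g) = residue_map r s A (residue_vector g)"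
  by (auto simp: residue_vector_def mat_map_def fun_eq_iff lookup_sum constant_coeff_mult)

lemma residue_vector_simps:
  "residue_vector 0 = 0"
  "residue_vector (f + g) = residue_vector f + residue_vector g"
  "residue_vector (f - g) = residue_vector f - residue_vector g"
  "residue_vector (truncate r f) = truncate r (residue_vector f)"
  by (auto simp: residue_vector_def fun_eq_iff lookup_add lookup_minus truncate_def)

text \<open>Every vector over \<open>k\<close> lifts to a polynomial vector. Identities between
  matrices over the ring can therefore be transported to their residue matrices.\<close>

lemma residue_vector_surj: "\<exists>g :: nat \<Rightarrow> ('v, 'k::field) mpoly. residue_vector g = c"
  by (rule exI[of _ "\<lambda>b. Poly_Mapping.single 0 (c b)"]) (simp add: residue_vector_def)

section \<open>Resolutions of quotient rings and comparison maps\<close>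

text \<open>Here \<open>rk E 0 = 1\<close>, and the image of \<open>bd E 0\<close> in the ring is the ideal; the component
  \<open>aug\<close> is not used.\<close>

definition quotient_resolution ::
    "('v, 'k::field) mpoly set \<Rightarrow> ('v, 'k) graded_complex \<Rightarrow> bool" where
  "quotient_resolution I E \<longleftrightarrow> rk E 0 = 1 \<and> shift E 0 0 = 0 \<and>
     (\<forall>i. homogeneous_matrix (rk E i) (rk E (Suc i)) (shift E i) (shift E (Suc i)) (bd E i)) \<and>
     range (bd_map E 0) = {f \<in> free_mod 1. f 0 \<in> I} \<and>
     (\<forall>i. {f \<in> free_mod (rk E (Suc i)). bd_map E i f = 0} = range (bd_map E (Suc i)))"

definition degreewise_map ::
    "('v, 'k::field) graded_complex \<Rightarrow> ('v, 'k) graded_complex \<Rightarrow> (nat \<Rightarrow> nat \<Rightarrow> nat \<Rightarrow> ('v, 'k) mpoly) \<Rightarrow>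
     nat \<Rightarrow> (nat \<Rightarrow> ('v, 'k) mpoly) \<Rightarrow> nat \<Rightarrow> ('v, 'k) mpoly" where
  "degreewise_map E E' \<Phi> i = mat_map (rk E' i) (rk E i) (\<Phi> i)"

text \<open>A graded chain map from \<open>E(-d)\<close> to \<open>E'\<close>. The twist by
  \<open>d\<close> lets it cover multiplication by a form of degree \<open>d\<close>.\<close>

definition chain_map :: "int \<Rightarrow>
    ('v, 'k::field) graded_complex \<Rightarrow> ('v, 'k) graded_complex \<Rightarrow> (nat \<Rightarrow> nat \<Rightarrow> nat \<Rightarrow> ('v, 'k) mpoly) \<Rightarrow> bool" where
  "chain_map d E E' \<Phi> \<longleftrightarrow>
     (\<forall>i. homogeneous_matrix (rk E' i) (rk E i) (shift E' i) (\<lambda>b. shift E i b + d) (\<Phi> i)) \<and>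
     (\<forall>i g. degreewise_map E E' \<Phi> i (bd_map E i g) = bd_map E' i (degreewise_map E E' \<Phi> (Suc i) g))"

lemma bd_map_free_mod [simp]: "bd_map E i f \<in> free_mod (rk E i)"
  by (simp add: bd_map_def)

lemma degreewise_map_free_mod [simp]: "degreewise_map E E' \<Phi> i f \<in> free_mod (rk E' i)"
  by (simp add: degreewise_map_def)

lemma bd_map_linear:
  "bd_map E i 0 = 0" "bd_map E i (f + g) = bd_map E i f + bd_map E i g"
  "bd_map E i (f - g) = bd_map E i f - bd_map E i g" "bd_map E i (- f) = - bd_map E i f"
  by (simp_all add: bd_map_def mat_map_add mat_map_diff mat_map_minus)

lemma quotient_resolution_complex:
  "quotient_resolution I E \<Longrightarrow> bd_map E i (bd_map E (Suc i) g) = 0"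
  unfolding quotient_resolution_def by blast

lemma quotient_resolution_exact:
  "quotient_resolution I E \<Longrightarrow> f \<in> free_mod (rk E (Suc i)) \<Longrightarrow> bd_map E i f = 0 \<Longrightarrow>
     f \<in> range (bd_map E (Suc i))"
  unfolding quotient_resolution_def by blast

lemma quotient_resolution_range_0:
  "quotient_resolution I E \<Longrightarrow> f \<in> range (bd_map E 0) \<longleftrightarrow> f \<in> free_mod 1 \<and> f 0 \<in> I"
  unfolding quotient_resolution_def by blast

lemma quotient_resolution_homogeneous:
  "quotient_resolution I E \<Longrightarrow>
     homogeneous_matrix (rk E i) (rk E (Suc i)) (shift E i) (shift E (Suc i)) (bd E i)"
  unfolding quotient_resolution_def by blast

lemma quotient_resolution_rk_shift_0:
  "quotient_resolution I E \<Longrightarrow> rk E 0 = 1" "quotient_resolution I E \<Longrightarrow> shift E 0 0 = 0"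
  unfolding quotient_resolution_def by blast+

text \<open>The hypothesis on \<open>q\<close> makes multiplication by \<open>q\<close> a map from
  \<open>R/J\<close> to \<open>R/I\<close>. It is lifted degree by degree, since \<open>E\<close> is
  free and \<open>E'\<close> is exact.\<close>

lemma chain_map_exists:
  fixes E E' :: "('v, 'k::field) graded_complex"
  assumes E: "quotient_resolution J E" and E': "quotient_resolution I E'"
    and q: "homogeneous d q" "\<And>g. g \<in> J \<Longrightarrow> q * g \<in> I"
  obtains \<Phi> where "chain_map d E E' \<Phi>" "\<Phi> 0 0 0 = q"
proof -
  let ?h = "\<lambda>i. homogeneous_matrix (rk E' i) (rk E i) (shift E' i) (\<lambda>b. shift E i b + d)"
  let ?m = "\<lambda>i. mat_map (rk E' i) (rk E i)"
  \<comment> \<open>The second conjunct is the invariant that makes the next lift possible: the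
    composite with \<open>bd_map E i\<close> lands in the image of
    \<open>bd_map E' i\<close>.\<close>
  let ?P = "\<lambda>i A. ?h i A \<and> (\<forall>g. ?m i A (bd_map E i g) \<in> range (bd_map E' i)) \<and> (i = 0 \<longrightarrow> A 0 0 = q)"
  let ?Q = "\<lambda>i A B. \<forall>g. ?m i A (bd_map E i g) = bd_map E' i (?m (Suc i) B g)"
  note rk0 = quotient_resolution_rk_shift_0[OF E] quotient_resolution_rk_shift_0[OF E']
  have "\<exists>\<Phi>. \<forall>i. ?P i (\<Phi> i) \<and> ?Q i (\<Phi> i) (\<Phi> (Suc i))"
  proof (rule dependent_nat_choice)
    have "bd_map E 0 g 0 \<in> J" for g
      using quotient_resolution_range_0[OF E, of "bd_map E 0 g"] by blast
    then have "?P 0 (\<lambda>a b. q)"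
      using q rk0 quotient_resolution_range_0[OF E']
      by (auto simp: homogeneous_matrix_def mat_map_def free_mod_def)
    then show "\<exists>A. ?P 0 A" by blast
  next
    fix A i assume A: "?P i A"
    have h: "homogeneous_matrix (rk E' i) (rk E (Suc i)) (shift E' i) (\<lambda>b. shift E (Suc i) b + d)
        (mat_mult (rk E i) A (bd E i))"
    proof (rule homogeneous_matrix_mat_mult)
      show "homogeneous_matrix (rk E i) (rk E (Suc i)) (\<lambda>b. shift E i b + d)
          (\<lambda>b. shift E (Suc i) b + d) (bd E i)"
        using quotient_resolution_homogeneous[OF E, of i] by (simp add: homogeneous_matrix_def)
    qed (use A in blast)
    obtain B where B: "?h (Suc i) B"
        "\<And>g. mat_map (rk E' i) (rk E' (Suc i)) (bd E' i) (?m (Suc i) B g) =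
          mat_map (rk E' i) (rk E (Suc i)) (mat_mult (rk E i) A (bd E i)) g"
      by (rule homogeneous_matrix_lift[OF quotient_resolution_homogeneous[OF E'] h])
        (use A in \<open>auto simp: mat_map_mat_mult bd_map_def\<close>)
    then have Q: "?Q i A B"
      by (simp add: mat_map_mat_mult bd_map_def)
    \<comment> \<open>The composite is a cycle because the square just built commutes and
      \<open>E\<close> is a complex; exactness of \<open>E'\<close> restores the invariant.\<close>
    have "?m (Suc i) B (bd_map E (Suc i) g) \<in> range (bd_map E' (Suc i))" for g
    proof (rule quotient_resolution_exact[OF E'])
      show "bd_map E' i (?m (Suc i) B (bd_map E (Suc i) g)) = 0"
        using Q quotient_resolution_complex[OF E] by (metis mat_map_zero)
    qed simp
    then show "\<exists>B. ?P (Suc i) B \<and> ?Q i A B"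
      using B(1) Q by blast
  qed
  then obtain \<Phi> where "\<And>i. ?P i (\<Phi> i)" "\<And>i. ?Q i (\<Phi> i) (\<Phi> (Suc i))" by blast
  then have "chain_map d E E' \<Phi>" "\<Phi> 0 0 0 = q"
    by (auto simp: chain_map_def degreewise_map_def)
  then show thesis by (rule that)
qed

text \<open>A chain map that vanishes in degree 0 induces zero on the resolved modules and so is
  null homotopic. The homotopy is again built by successive lifting.\<close>

lemma null_homotopy_exists:
  fixes E E' :: "('v, 'k::field) graded_complex"
  assumes E: "quotient_resolution J E" and E': "quotient_resolution I E'"
    and \<Theta>: "chain_map d E E' \<Theta>" "\<And>g. degreewise_map E E' \<Theta> 0 g = 0"
  obtains S where
    "\<And>i. homogeneous_matrix (rk E' (Suc i)) (rk E i) (shift E' (Suc i)) (\<lambda>b. shift E i b + d) (S i)"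
    "\<And>i g. degreewise_map E E' \<Theta> (Suc i) g =
       bd_map E' (Suc i) (mat_map (rk E' (Suc (Suc i))) (rk E (Suc i)) (S (Suc i)) g) +
       mat_map (rk E' (Suc i)) (rk E i) (S i) (bd_map E i g)"
proof -
  let ?h = "\<lambda>i. homogeneous_matrix (rk E' (Suc i)) (rk E i) (shift E' (Suc i)) (\<lambda>b. shift E i b + d)"
  let ?m = "\<lambda>i. mat_map (rk E' (Suc i)) (rk E i)"
  let ?t = "degreewise_map E E' \<Theta>"
  let ?P = "\<lambda>i A. ?h i A \<and> (\<forall>g. ?t (Suc i) g - ?m i A (bd_map E i g) \<in> range (bd_map E' (Suc i)))"
  let ?Q = "\<lambda>i A B. \<forall>g. ?t (Suc i) g = bd_map E' (Suc i) (?m (Suc i) B g) + ?m i A (bd_map E i g)"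
  have chain: "?t i (bd_map E i g) = bd_map E' i (?t (Suc i) g)" for i g
    using \<Theta>(1) by (simp add: chain_map_def)
  have "\<exists>S. \<forall>i. ?P i (S i) \<and> ?Q i (S i) (S (Suc i))"
  proof (rule dependent_nat_choice)
    \<comment> \<open>\<open>S 0 = 0\<close> is a valid start: as \<open>\<Theta>\<close> vanishes
      in degree 0, in degree 1 it maps into cycles, hence into boundaries.\<close>
    have "?t (Suc 0) g \<in> range (bd_map E' (Suc 0))" for g
      by (rule quotient_resolution_exact[OF E']) (use chain[of 0 g] \<Theta>(2) in auto)
    moreover have "?m 0 (\<lambda>a b. 0 :: ('v, 'k) mpoly) g = 0" for g
      by (auto simp: mat_map_def fun_eq_iff)
    ultimately have "?P 0 (\<lambda>a b. 0)"
      by (simp add: homogeneous_matrix_def)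
    then show "\<exists>A. ?P 0 A" by blast
  next
    fix A i assume A: "?P i A"
    \<comment> \<open>The part of \<open>\<Theta>\<close> in degree \<open>Suc i\<close> not yet
      accounted for by \<open>S i\<close>; lifting it through \<open>bd E' (Suc i)\<close> gives
      \<open>S (Suc i)\<close>.\<close>
    let ?C = "\<lambda>a b. \<Theta> (Suc i) a b - mat_mult (rk E i) A (bd E i) a b"
    have C: "mat_map (rk E' (Suc i)) (rk E (Suc i)) ?C g = ?t (Suc i) g - ?m i A (bd_map E i g)" for g
      by (simp add: mat_map_minus_matrix mat_map_mat_mult degreewise_map_def bd_map_def)
    have h: "homogeneous_matrix (rk E' (Suc i)) (rk E (Suc i)) (shift E' (Suc i))
        (\<lambda>b. shift E (Suc i) b + d) ?C"
    proof (intro homogeneous_matrix_diff homogeneous_matrix_mat_mult)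
      show "homogeneous_matrix (rk E i) (rk E (Suc i)) (\<lambda>b. shift E i b + d)
          (\<lambda>b. shift E (Suc i) b + d) (bd E i)"
        using quotient_resolution_homogeneous[OF E, of i] by (simp add: homogeneous_matrix_def)
    qed (use A \<Theta>(1) in \<open>simp_all add: chain_map_def\<close>)
    obtain B where B: "?h (Suc i) B"
        "\<And>g. mat_map (rk E' (Suc i)) (rk E' (Suc (Suc i))) (bd E' (Suc i)) (?m (Suc i) B g) =
          mat_map (rk E' (Suc i)) (rk E (Suc i)) ?C g"
      by (rule homogeneous_matrix_lift[OF quotient_resolution_homogeneous[OF E'] h])
        (use A C in \<open>auto simp: bd_map_def\<close>)
    then have Q: "?Q i A B"
      by (simp add: C bd_map_def)
    have "?t (Suc (Suc i)) g - ?m (Suc i) B (bd_map E (Suc i) g) \<in> range (bd_map E' (Suc (Suc i)))" for g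
    proof (rule quotient_resolution_exact[OF E'])
      have "?t (Suc i) (bd_map E (Suc i) g) = bd_map E' (Suc i) (?m (Suc i) B (bd_map E (Suc i) g))"
        using Q quotient_resolution_complex[OF E] by (metis mat_map_zero add_0_right)
      then show "bd_map E' (Suc i) (?t (Suc (Suc i)) g - ?m (Suc i) B (bd_map E (Suc i) g)) = 0"
        by (simp add: bd_map_linear chain[symmetric])
    qed simp
    then show "\<exists>B. ?P (Suc i) B \<and> ?Q i A B"
      using B(1) Q by blast
  qed
  then show thesis using that by blast
qed

section \<open>Invariance of Tor\<close>

text \<open>A nonzero constant coefficient of \<open>A a b\<close> forces its degree
  \<open>\<tau> b - \<sigma> a\<close> to be 0, so the residue matrix connects only generators of
  equal degree.\<close>

lemma residue_map_tensor_part: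
  assumes A: "homogeneous_matrix r s \<sigma> \<tau> A" and c: "\<And>b. b < s \<Longrightarrow> \<tau> b \<noteq> j \<Longrightarrow> c b = 0"
    and a: "a < r" "\<sigma> a \<noteq> j"
  shows "residue_map r s A c a = 0"
proof -
  have "Poly_Mapping.lookup (A a b) 0 * c b = 0" if "b < s" for b
    using that a c[of b] A homogeneous_constant_coeff[of "\<tau> b - \<sigma> a" "A a b"]
    by (cases "\<tau> b = j") (auto simp: homogeneous_matrix_def)
  then show ?thesis
    by (auto simp: mat_map_def intro!: sum.neutral)
qed

lemma subspace_tensor_part: "fun_space.subspace (tensor_part F i j)"
  by (auto simp: fun_space.subspace_def tensor_part_def free_mod_def fun_scale_def)

lemma linear_tensor_bd: "Vector_Spaces.linear fun_scale fun_scale (tensor_bd F i)"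
  unfolding tensor_bd_def by (rule linear_mat_map)

lemma tensor_bd_linear:
  "tensor_bd F i 0 = 0" "tensor_bd F i (f + g) = tensor_bd F i f + tensor_bd F i g"
  "tensor_bd F i (f - g) = tensor_bd F i f - tensor_bd F i g"
  "tensor_bd F i (fun_scale x f) = fun_scale x (tensor_bd F i f)"
  by (simp_all add: tensor_bd_def mat_map_add mat_map_diff mat_map_fun_scale)

lemma tor_cycles_Suc:
  "tor_cycles F (Suc i) j = {c \<in> tensor_part F (Suc i) j. tensor_bd F i c = 0}"
  by (simp add: tor_cycles_def)

lemma subspace_tor_cycles: "fun_space.subspace (tor_cycles F i j)"
  using subspace_tensor_part[of F i j]
  by (auto simp: fun_space.subspace_def tor_cycles_def tensor_bd_linear)

lemma subspace_tor_boundaries: "fun_space.subspace (tor_boundaries F i j)"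
  unfolding tor_boundaries_def
  by (rule fun_pair.linear_subspace_image[OF linear_tensor_bd subspace_tensor_part])

lemma residue_vector_bd_map: "residue_vector (bd_map F i g) = tensor_bd F i (residue_vector g)"
  by (simp add: bd_map_def tensor_bd_def residue_vector_mat_map)

lemma tensor_bd_tensor_part:
  assumes "quotient_resolution I E" "c \<in> tensor_part E (Suc i) j"
  shows "tensor_bd E i c \<in> tensor_part E i j"
  using residue_map_tensor_part[OF quotient_resolution_homogeneous[OF assms(1), of i], of j c] assms(2)
  by (auto simp: tensor_part_def tensor_bd_def)

lemma tensor_bd_complex:
  fixes E :: "('v, 'k::field) graded_complex"
  assumes "quotient_resolution I E"
  shows "tensor_bd E i (tensor_bd E (Suc i) c) = 0"
proof -
  obtain g :: "nat \<Rightarrow> ('v, 'k) mpoly" where "residue_vector g = c"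
    using residue_vector_surj by blast
  then show ?thesis
    using quotient_resolution_complex[OF assms, of i g]
    by (metis residue_vector_bd_map residue_vector_simps(1))
qed

lemma tor_boundaries_subset_cycles:
  assumes "quotient_resolution I E"
  shows "tor_boundaries E i j \<subseteq> tor_cycles E i j"
  using tensor_bd_tensor_part[OF assms] tensor_bd_complex[OF assms]
  by (auto simp: tor_boundaries_def tor_cycles_def)

text \<open>Lift the identity of \<open>R/I\<close> both ways to \<open>\<Phi>\<close> and
  \<open>\<Psi>\<close>. Their composite differs from the identity by a null homotopy, so after
  tensoring with \<open>k\<close> the map induced by \<open>\<Phi>\<close> on Tor is injective.
  Exchanging the resolutions gives equality.\<close>

lemma tor_dim_le:
  fixes E E' :: "('v, 'k::field) graded_complex"
  assumes E: "quotient_resolution I E" and E': "quotient_resolution I E'"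
  shows "tor_dim E (Suc i) j \<le> tor_dim E' (Suc i) j"
proof -
  obtain \<Phi> where \<Phi>: "chain_map 0 E E' \<Phi>" "\<Phi> 0 0 0 = 1"
    using chain_map_exists[OF E E', of 0 1] by auto
  obtain \<Psi> where \<Psi>: "chain_map 0 E' E \<Psi>" "\<Psi> 0 0 0 = 1"
    using chain_map_exists[OF E' E, of 0 1] by auto
  define \<Theta> where "\<Theta> i = (\<lambda>a b. mat_mult (rk E' i) (\<Psi> i) (\<Phi> i) a b - of_bool (a = b))" for i
  have \<Theta>_map: "degreewise_map E E \<Theta> i g =
      degreewise_map E' E \<Psi> i (degreewise_map E E' \<Phi> i g) - truncate (rk E i) g" for i g
    by (simp add: degreewise_map_def \<Theta>_def mat_map_minus_matrix mat_map_mat_mult mat_map_identity)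
  have "chain_map 0 E E \<Theta>"
    unfolding chain_map_def
  proof (intro conjI allI)
    show "homogeneous_matrix (rk E i) (rk E i) (shift E i) (\<lambda>b. shift E i b + 0) (\<Theta> i)" for i
      unfolding \<Theta>_def using \<Phi>(1) \<Psi>(1)
      by (auto simp: chain_map_def intro!: homogeneous_matrix_diff
          homogeneous_matrix_mat_mult[of _ _ _ "shift E' i"] homogeneous_matrix_identity)
    have "bd_map E i (truncate (rk E (Suc i)) g) = bd_map E i g" for i g
      by (simp add: bd_map_def)
    then show "degreewise_map E E \<Theta> i (bd_map E i g) = bd_map E i (degreewise_map E E \<Theta> (Suc i) g)" for i g
      using \<Phi>(1) \<Psi>(1) by (simp add: \<Theta>_map chain_map_def bd_map_linear truncate_id)
  qed
  \<comment> \<open>In degree 0 both resolutions have rank 1 and both lifts are the matrix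
    \<open>1\<close>, so the difference to the identity vanishes.\<close>
  moreover have "degreewise_map E E \<Theta> 0 g = 0" for g
    using \<Phi>(2) \<Psi>(2) quotient_resolution_rk_shift_0[OF E] quotient_resolution_rk_shift_0[OF E']
    by (auto simp: degreewise_map_def mat_map_def \<Theta>_def mat_mult_def fun_eq_iff)
  ultimately obtain S where S:
    "\<And>i. homogeneous_matrix (rk E (Suc i)) (rk E i) (shift E (Suc i)) (\<lambda>b. shift E i b + 0) (S i)"
    "\<And>i g. degreewise_map E E \<Theta> (Suc i) g =
       bd_map E (Suc i) (mat_map (rk E (Suc (Suc i))) (rk E (Suc i)) (S (Suc i)) g) +
       mat_map (rk E (Suc i)) (rk E i) (S i) (bd_map E i g)"
    by (rule null_homotopy_exists[OF E E]) (rule that)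
  let ?f = "\<lambda>i. residue_map (rk E' i) (rk E i) (\<Phi> i)" and ?g = "\<lambda>i. residue_map (rk E i) (rk E' i) (\<Psi> i)"
  let ?s = "\<lambda>i. residue_map (rk E (Suc i)) (rk E i) (S i)"
  have f: "?f i c \<in> tensor_part E' i j" if "c \<in> tensor_part E i j" for i c
    using that \<Phi>(1) residue_map_tensor_part[of "rk E' i" "rk E i" "shift E' i" "shift E i" "\<Phi> i" j c]
    by (auto simp: tensor_part_def chain_map_def)
  have g: "?g i c \<in> tensor_part E i j" if "c \<in> tensor_part E' i j" for i c
    using that \<Psi>(1) residue_map_tensor_part[of "rk E i" "rk E' i" "shift E i" "shift E' i" "\<Psi> i" j c]
    by (auto simp: tensor_part_def chain_map_def)
  have s: "?s i c \<in> tensor_part E (Suc i) j" if "c \<in> tensor_part E i j" for i c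
    using that S(1) residue_map_tensor_part[of "rk E (Suc i)" "rk E i" "shift E (Suc i)" "shift E i" "S i" j c]
    by (auto simp: tensor_part_def)
  have f_chain: "?f i (tensor_bd E i c) = tensor_bd E' i (?f (Suc i) c)" for i c
  proof -
    obtain x :: "nat \<Rightarrow> ('v, 'k) mpoly" where x: "residue_vector x = c" using residue_vector_surj by blast
    have "residue_vector (degreewise_map E E' \<Phi> i (bd_map E i x)) =
        residue_vector (bd_map E' i (degreewise_map E E' \<Phi> (Suc i) x))"
      using \<Phi>(1) by (simp add: chain_map_def)
    then show ?thesis
      by (simp add: degreewise_map_def residue_vector_mat_map residue_vector_bd_map x)
  qed
  have g_chain: "?g i (tensor_bd E' i c) = tensor_bd E i (?g (Suc i) c)" for i c
  proof -
    obtain x :: "nat \<Rightarrow> ('v, 'k) mpoly" where x: "residue_vector x = c" using residue_vector_surj by blast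
    have "residue_vector (degreewise_map E' E \<Psi> i (bd_map E' i x)) =
        residue_vector (bd_map E i (degreewise_map E' E \<Psi> (Suc i) x))"
      using \<Psi>(1) by (simp add: chain_map_def)
    then show ?thesis
      by (simp add: degreewise_map_def residue_vector_mat_map residue_vector_bd_map x)
  qed
  have homotopy: "?g (Suc i) (?f (Suc i) c) - truncate (rk E (Suc i)) c =
      tensor_bd E (Suc i) (?s (Suc i) c) + ?s i (tensor_bd E i c)" for i c
  proof -
    obtain x :: "nat \<Rightarrow> ('v, 'k) mpoly" where x: "residue_vector x = c" using residue_vector_surj by blast
    show ?thesis
      using arg_cong[OF S(2)[of i x], of residue_vector]
      by (simp add: \<Theta>_map) (simp add: degreewise_map_def residue_vector_mat_map
          residue_vector_bd_map residue_vector_simps x)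
  qed
  have reflects: "c \<in> tor_boundaries E (Suc i) j"
    if c: "c \<in> tor_cycles E (Suc i) j" "?f (Suc i) c \<in> tor_boundaries E' (Suc i) j" for c
  proof -
    obtain b where b: "b \<in> tensor_part E' (Suc (Suc i)) j" "?f (Suc i) c = tensor_bd E' (Suc i) b"
      using c(2) by (auto simp: tor_boundaries_def)
    have c': "c \<in> tensor_part E (Suc i) j" "tensor_bd E i c = 0"
      using c(1) by (auto simp: tor_cycles_Suc)
    then have "truncate (rk E (Suc i)) c = c"
      by (simp add: truncate_id tensor_part_def)
    \<comment> \<open>As \<open>c\<close> is a cycle, the homotopy reads
      \<open>g (f c) - c = bd (s c)\<close>. With \<open>f c = bd b\<close> and \<open>g\<close> a
      chain map, \<open>c\<close> becomes a boundary.\<close>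
    then have "c = tensor_bd E (Suc i) (?g (Suc (Suc i)) b - ?s (Suc i) c)"
      using homotopy[of i c] c'(2) b(2) by (simp add: g_chain tensor_bd_linear algebra_simps)
    moreover have "?g (Suc (Suc i)) b - ?s (Suc i) c \<in> tensor_part E (Suc (Suc i)) j"
      by (intro fun_space.subspace_diff subspace_tensor_part g s b c')
    ultimately show ?thesis
      by (auto simp: tor_boundaries_def)
  qed
  obtain X :: "(nat \<Rightarrow> 'k) set" where X: "finite X" "free_mod (rk E (Suc i)) \<subseteq> fun_space.span X"
    using free_mod_finite_span by blast
  obtain Y :: "(nat \<Rightarrow> 'k) set" where Y: "finite Y" "free_mod (rk E' (Suc i)) \<subseteq> fun_space.span Y"
    using free_mod_finite_span by blast
  have "fun_space.dim (tor_cycles E (Suc i) j) + fun_space.dim (tor_boundaries E' (Suc i) j) \<le>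
      fun_space.dim (tor_cycles E' (Suc i) j) + fun_space.dim (tor_boundaries E (Suc i) j)"
  proof (rule fun_pair.dim_quotient_le[OF linear_mat_map X(1) _ Y(1)])
    show "tor_cycles E (Suc i) j \<subseteq> fun_space.span X" "tor_cycles E' (Suc i) j \<subseteq> fun_space.span Y"
      using X(2) Y(2) by (auto simp: tor_cycles_def tensor_part_def)
    show "?f (Suc i) ` tor_cycles E (Suc i) j \<subseteq> tor_cycles E' (Suc i) j"
      using f by (auto simp: tor_cycles_Suc f_chain[symmetric])
  qed (use reflects tor_boundaries_subset_cycles[OF E] tor_boundaries_subset_cycles[OF E'] in
      \<open>simp_all add: subspace_tor_cycles subspace_tor_boundaries\<close>)
  then show ?thesis
    unfolding tor_dim_def by linarith
qed

lemma tor_dim_eq: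
  "quotient_resolution I E \<Longrightarrow> quotient_resolution I E' \<Longrightarrow> tor_dim E (Suc i) j = tor_dim E' (Suc i) j"
  using tor_dim_le by (metis order_antisym)

section \<open>Betti numbers from resolutions of the quotient ring\<close>

text \<open>Prepending \<open>R\<close> in homological degree 0, with \<open>aug\<close> as
  differential, turns a resolution of \<open>I\<close> into one of \<open>R/I\<close>. The operation
  \<open>unaugment\<close> goes back.\<close>

definition augment :: "('v, 'k::field) graded_complex \<Rightarrow> ('v, 'k) graded_complex" where
  "augment F = \<lparr>rk = case_nat 1 (rk F), shift = case_nat (\<lambda>_. 0) (shift F), aug = aug F,
     bd = case_nat (\<lambda>a b. aug F b) (bd F)\<rparr>"

definition unaugment :: "('v, 'k::field) graded_complex \<Rightarrow> ('v, 'k) graded_complex" where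
  "unaugment E = \<lparr>rk = \<lambda>i. rk E (Suc i), shift = \<lambda>i. shift E (Suc i), aug = bd E 0 0,
     bd = \<lambda>i. bd E (Suc i)\<rparr>"

lemma augment_simps [simp]:
  "rk (augment F) 0 = 1" "rk (augment F) (Suc i) = rk F i"
  "shift (augment F) 0 = (\<lambda>_. 0)" "shift (augment F) (Suc i) = shift F i"
  "bd (augment F) 0 = (\<lambda>a b. aug F b)" "bd (augment F) (Suc i) = bd F i"
  by (simp_all add: augment_def)

lemma unaugment_simps [simp]:
  "rk (unaugment E) = (\<lambda>i. rk E (Suc i))" "shift (unaugment E) = (\<lambda>i. shift E (Suc i))"
  "aug (unaugment E) = bd E 0 0" "bd (unaugment E) = (\<lambda>i. bd E (Suc i))"
  by (simp_all add: unaugment_def)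

lemma image_bd_map: "bd_map F i ` free_mod (rk F (Suc i)) = range (bd_map F i)"
  unfolding bd_map_def by (rule image_mat_map)

lemma quotient_resolution_augment:
  fixes F :: "('v, 'k::field) graded_complex"
  assumes F: "graded_free_resolution I F"
  shows "quotient_resolution I (augment F)"
proof -
  have bd0: "bd_map (augment F) 0 f = (\<lambda>a. if a = 0 then aug_map F f else 0)" for f
    by (auto simp: bd_map_def mat_map_def aug_map_def fun_eq_iff)
  have bd_Suc: "bd_map (augment F) (Suc i) = bd_map F i" for i
    by (simp add: bd_map_def fun_eq_iff)
  have aug: "aug_map F (truncate (rk F 0) f) = aug_map F f" for f
    by (simp add: aug_map_def truncate_def)
  have ideal: "range (aug_map F) = I"
  proof -
    have "aug_map F f \<in> aug_map F ` free_mod (rk F 0)" for f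
      using imageI[OF truncate_free_mod, of "aug_map F" "rk F 0" f] by (simp only: aug)
    then have "range (aug_map F) = aug_map F ` free_mod (rk F 0)" by blast
    then show ?thesis
      using F by (simp add: graded_free_resolution_def)
  qed
  have "{f \<in> free_mod 1. f 0 \<in> I} \<subseteq> range (bd_map (augment F) 0)"
  proof
    fix f assume "f \<in> {f \<in> free_mod 1. f 0 \<in> I}"
    then have f: "f \<in> free_mod 1" "f 0 \<in> range (aug_map F)"
      using ideal by auto
    then obtain g where "f 0 = aug_map F g" by blast
    with f(1) have "f = bd_map (augment F) 0 g"
      by (auto simp: bd0 free_mod_def fun_eq_iff)
    then show "f \<in> range (bd_map (augment F) 0)" by blast
  qed
  moreover have "range (bd_map (augment F) 0) \<subseteq> {f \<in> free_mod 1. f 0 \<in> I}"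
    using ideal by (auto simp: bd0 free_mod_def)
  moreover have "{f \<in> free_mod (rk F 0). bd_map (augment F) 0 f = 0} = range (bd_map F 0)"
  proof -
    have "bd_map (augment F) 0 f = 0 \<longleftrightarrow> aug_map F f = 0" for f
      by (auto simp: bd0 fun_eq_iff)
    then show ?thesis
      using F image_bd_map[of F 0] by (simp add: graded_free_resolution_def)
  qed
  then have "{f \<in> free_mod (rk (augment F) (Suc i)). bd_map (augment F) i f = 0} =
      range (bd_map (augment F) (Suc i))" for i
    using F image_bd_map[of F] by (cases i) (simp_all add: graded_free_resolution_def bd_Suc)
  moreover have "homogeneous_matrix (rk (augment F) i) (rk (augment F) (Suc i)) (shift (augment F) i)
      (shift (augment F) (Suc i)) (bd (augment F) i)" for i
    using F by (cases i) (simp_all add: graded_free_resolution_def homogeneous_matrix_def)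
  ultimately show ?thesis
    unfolding quotient_resolution_def by (intro conjI allI) (simp, simp, blast, blast, blast)
qed

lemma graded_free_resolution_unaugment:
  fixes E :: "('v, 'k::field) graded_complex"
  assumes E: "quotient_resolution I E"
  shows "graded_free_resolution I (unaugment E)"
proof -
  note rk0 = quotient_resolution_rk_shift_0[OF E]
  have bd0: "bd_map E 0 f = (\<lambda>a. if a = 0 then aug_map (unaugment E) f else 0)" for f
    using rk0 by (auto simp: bd_map_def mat_map_def aug_map_def fun_eq_iff)
  have bd_Suc: "bd_map (unaugment E) i = bd_map E (Suc i)" for i
    by (simp add: bd_map_def fun_eq_iff)
  have aug: "aug_map (unaugment E) (truncate (rk E 1) f) = aug_map (unaugment E) f" for f
    by (simp add: aug_map_def truncate_def)
  have "aug_map (unaugment E) ` free_mod (rk E 1) = I"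
  proof (intro subset_antisym subsetI)
    fix x assume "x \<in> aug_map (unaugment E) ` free_mod (rk E 1)"
    then obtain f where "x = bd_map E 0 f 0"
      by (auto simp: bd0)
    then show "x \<in> I"
      using quotient_resolution_range_0[OF E, of "bd_map E 0 f"] by blast
  next
    fix x assume "x \<in> I"
    then have "(\<lambda>a. if a = 0 then x else 0) \<in> range (bd_map E 0)"
      using quotient_resolution_range_0[OF E] by (simp add: free_mod_def)
    then obtain f where "(\<lambda>a. if a = 0 then x else 0) = bd_map E 0 f"
      by blast
    from fun_cong[OF this, of 0] have "x = aug_map (unaugment E) f"
      by (simp add: bd0)
    then show "x \<in> aug_map (unaugment E) ` free_mod (rk E 1)"
      by (metis aug imageI truncate_free_mod)
  qed
  moreover have "{f \<in> free_mod (rk E (Suc 0)). aug_map (unaugment E) f = 0} = range (bd_map E (Suc 0))"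
  proof -
    have "bd_map E 0 f = 0 \<longleftrightarrow> aug_map (unaugment E) f = 0" for f
      by (auto simp: bd0 fun_eq_iff)
    moreover have "{f \<in> free_mod (rk E (Suc 0)). bd_map E 0 f = 0} = range (bd_map E (Suc 0))"
      using E unfolding quotient_resolution_def by blast
    ultimately show ?thesis by simp
  qed
  moreover have "homogeneous (shift E (Suc 0) b) (bd E 0 0 b)" if "b < rk E (Suc 0)" for b
    using quotient_resolution_homogeneous[OF E, of 0] rk0 that by (auto simp: homogeneous_matrix_def)
  ultimately show ?thesis
    using E image_bd_map[of "unaugment E"]
    by (simp add: quotient_resolution_def graded_free_resolution_def homogeneous_matrix_def bd_Suc)
qed

text \<open>The only possible difference is at \<open>i = 0\<close>, where elements of degree 1 in
  the augmented complex must also be killed by its differential to degree 0. That differential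
  vanishes over \<open>k\<close>, because the entries of \<open>aug\<close> have no constant
  term.\<close>

lemma tor_dim_augment: "tor_dim F i j = tor_dim (augment F) (Suc i) j"
  if "\<And>b. b < rk F 0 \<Longrightarrow> Poly_Mapping.lookup (aug F b) 0 = 0"
proof -
  have "tensor_bd (augment F) 0 c = 0" for c
    using that by (auto simp: tensor_bd_def mat_map_def fun_eq_iff)
  moreover have "tensor_bd (augment F) (Suc h) = tensor_bd F h" for h
    by (simp add: tensor_bd_def)
  moreover have "tensor_part (augment F) (Suc h) j = tensor_part F h j" for h
    by (simp add: tensor_part_def)
  ultimately show ?thesis
    by (cases i) (simp_all add: tor_dim_def tor_cycles_def tor_boundaries_def)
qed

lemma fun_space_dim_zero: "fun_space.dim {0 :: nat \<Rightarrow> 'k::field} = 0"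
  using fun_space.dim_unique[of "{}" "{0}" 0] by (simp add: fun_space.independent_empty)

text \<open>The image of \<open>bd_map E 0\<close> is \<open>I\<close>, which has no constant terms.
  Over \<open>k\<close> there are thus no boundaries in homological degree 0, and the single
  generator of degree 0 survives.\<close>

lemma tor_dim_0:
  fixes E :: "('v, 'k::field) graded_complex"
  assumes E: "quotient_resolution I E" and I: "\<And>p. p \<in> I \<Longrightarrow> Poly_Mapping.lookup p 0 = 0"
  shows "tor_dim E 0 j = (if j = 0 then 1 else 0)"
proof -
  note rk0 = quotient_resolution_rk_shift_0[OF E]
  have "tensor_bd E 0 c = 0" for c
  proof -
    obtain g :: "nat \<Rightarrow> ('v, 'k) mpoly" where g: "residue_vector g = c"
      using residue_vector_surj by blast
    have "bd_map E 0 g \<in> free_mod 1" "bd_map E 0 g 0 \<in> I"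
      using quotient_resolution_range_0[OF E] by blast+
    then have "residue_vector (bd_map E 0 g) a = 0" for a
      using I by (cases "a = 0") (auto simp: residue_vector_def free_mod_def)
    then show ?thesis
      using g by (auto simp: residue_vector_bd_map fun_eq_iff)
  qed
  moreover have "0 \<in> tensor_part E (Suc 0) j"
    by (rule fun_space.subspace_0[OF subspace_tensor_part])
  ultimately have "tor_boundaries E 0 j = {0}"
    by (auto simp: tor_boundaries_def)
  moreover have "fun_space.dim (tor_cycles E 0 j) = (if j = 0 then 1 else 0)"
  proof (cases "j = 0")
    case True
    let ?e = "\<lambda>b. if b = 0 then 1 else (0 :: 'k)"
    have "tor_cycles E 0 j = free_mod 1"
      using rk0 True by (auto simp: tor_cycles_def tensor_part_def)
    moreover have "fun_space.dim (free_mod 1 :: (nat \<Rightarrow> 'k) set) = 1"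
    proof (rule fun_space.dim_unique[of "{?e}"])
      have "?e \<noteq> 0"
        by (auto simp: fun_eq_iff)
      then show "fun_space.independent {?e}"
        using fun_space.independent_insert[of ?e "{}"] fun_space.independent_empty by simp
      show "free_mod 1 \<subseteq> fun_space.span {?e}"
      proof
        fix f :: "nat \<Rightarrow> 'k" assume "f \<in> free_mod 1"
        then have "f = fun_scale (f 0) ?e"
          by (auto simp: free_mod_def fun_scale_def fun_eq_iff)
        then show "f \<in> fun_space.span {?e}"
          by (metis fun_space.span_base fun_space.span_scale singletonI)
      qed
    qed (auto simp: free_mod_def)
    ultimately show ?thesis
      using True by simp
  next
    case False
    have "c = 0" if "c \<in> tor_cycles E 0 j" for c
    proof
      show "c b = 0 b" for b
        using that rk0 False by (cases "b = 0") (auto simp: tor_cycles_def tensor_part_def free_mod_def)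
    qed
    then have "tor_cycles E 0 j = {0}"
      using fun_space.subspace_0[OF subspace_tor_cycles] by blast
    then show ?thesis
      using False by (simp add: fun_space_dim_zero)
  qed
  ultimately show ?thesis
    by (simp add: tor_dim_def fun_space_dim_zero)
qed

text \<open>The resolution of \<open>I\<close> chosen by the definition becomes, after augmenting, a
  resolution of \<open>R/I\<close>, which can be compared with \<open>E\<close> in positive
  homological degrees. For \<open>i = 0\<close> the convention for index -1 agrees with
  \<open>tor_dim_0\<close>.\<close>

lemma graded_betti_eq_tor_dim:
  fixes E :: "('v::finite, 'k::field) graded_complex"
  assumes E: "quotient_resolution I E" and I: "\<And>p. p \<in> I \<Longrightarrow> Poly_Mapping.lookup p 0 = 0"
  shows "graded_betti I (int i - 1) j = tor_dim E i j"
proof (cases i)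
  case 0
  then show ?thesis
    using tor_dim_0[OF E I] by (simp add: graded_betti_def)
next
  case (Suc h)
  define F where "F = (SOME F :: ('v, 'k) graded_complex. graded_free_resolution I F)"
  have F: "graded_free_resolution I F"
    unfolding F_def using graded_free_resolution_unaugment[OF E] by (rule someI)
  \<comment> \<open>The entries of \<open>aug\<close> are images of unit vectors, hence elements of
    \<open>I\<close>.\<close>
  have "Poly_Mapping.lookup (aug F b) 0 = 0" if b: "b < rk F 0" for b
  proof (rule I)
    let ?e = "\<lambda>c. of_bool (c = b) :: ('v, 'k) mpoly"
    have "aug_map F ?e = aug F b"
      using b by (simp add: aug_map_def)
    moreover have "?e \<in> free_mod (rk F 0)"
      using b by (auto simp: free_mod_def)
    ultimately show "aug F b \<in> I"
      using F unfolding graded_free_resolution_def by (metis imageI)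
  qed
  then have "tor_dim F h j = tor_dim E (Suc h) j"
    using tor_dim_augment tor_dim_eq[OF quotient_resolution_augment[OF F] E] by metis
  then show ?thesis
    using Suc by (simp add: graded_betti_def F_def[symmetric])
qed

section \<open>Mapping cones\<close>

text \<open>The mapping cone of a map from \<open>E'(-d)\<close> to \<open>E\<close>, with
  \<open>E'\<close> moved up by one homological degree. At \<open>i = 0\<close> the second summand
  has rank 0, so the truncated index \<open>i - 1\<close> in \<open>shift\<close> is not reached by
  any generator.\<close>

definition cone :: "int \<Rightarrow> ('v, 'k::field) graded_complex \<Rightarrow> ('v, 'k) graded_complex \<Rightarrow>
    (nat \<Rightarrow> nat \<Rightarrow> nat \<Rightarrow> ('v, 'k) mpoly) \<Rightarrow> ('v, 'k) graded_complex" where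
  "cone d E E' \<Psi> = \<lparr>
     rk = \<lambda>i. rk E i + case_nat 0 (rk E') i,
     shift = \<lambda>i b. if b < rk E i then shift E i b else shift E' (i - 1) (b - rk E i) + d,
     aug = aug E,
     bd = \<lambda>i. block (rk E i) (rk E (Suc i)) (bd E i) (\<Psi> i) (case_nat (\<lambda>_ _. 0) (bd E') i)\<rparr>"

lemma rk_cone [simp]:
  "rk (cone d E E' \<Psi>) 0 = rk E 0" "rk (cone d E E' \<Psi>) (Suc i) = rk E (Suc i) + rk E' i"
  by (simp_all add: cone_def)

lemma join_0_right: "f \<in> free_mod r \<Longrightarrow> join r f 0 = f"
  by (auto simp: join_def free_mod_def)

lemma bd_map_cone_0:
  "bd_map (cone d E E' \<Psi>) 0 (join (rk E (Suc 0)) f g) = bd_map E 0 f + degreewise_map E' E \<Psi> 0 g"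
proof -
  have "mat_map 0 s C g = 0" for s C
    by (auto simp: mat_map_def fun_eq_iff)
  then show ?thesis
    using mat_map_block[of "rk E 0" 0 "rk E (Suc 0)" "rk E' 0" "bd E 0" "\<Psi> 0" "\<lambda>_ _. 0" f g]
    by (simp add: bd_map_def degreewise_map_def cone_def join_0_right)
qed

lemma bd_map_cone_Suc:
  "bd_map (cone d E E' \<Psi>) (Suc i) (join (rk E (Suc (Suc i))) f g) =
     join (rk E (Suc i)) (bd_map E (Suc i) f + degreewise_map E' E \<Psi> (Suc i) g) (- bd_map E' i g)"
  unfolding bd_map_def degreewise_map_def by (simp add: cone_def mat_map_block)

lemma homogeneous_matrix_cone:
  assumes E: "quotient_resolution I E" and E': "quotient_resolution J E'" and \<Psi>: "chain_map d E' E \<Psi>"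
  defines "C \<equiv> cone d E E' \<Psi>"
  shows "homogeneous_matrix (rk C i) (rk C (Suc i)) (shift C i) (shift C (Suc i)) (bd C i)"
proof -
  have 1: "homogeneous (shift E (Suc i) b - shift E i a) (bd E i a b)" if "a < rk E i" "b < rk E (Suc i)" for a b
    using quotient_resolution_homogeneous[OF E, of i] that by (simp add: homogeneous_matrix_def)
  have 2: "homogeneous (shift E' (Suc i) b - shift E' i a) (bd E' i a b)"
    if "a < rk E' i" "b < rk E' (Suc i)" for a b i
    using quotient_resolution_homogeneous[OF E', of i] that by (simp add: homogeneous_matrix_def)
  have 3: "homogeneous (shift E' i b + d - shift E i a) (\<Psi> i a b)" if "a < rk E i" "b < rk E' i" for a b
    using \<Psi> that by (auto simp: chain_map_def homogeneous_matrix_def)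
  show ?thesis
    using 1 2[where i = "i - 1"] 3 unfolding homogeneous_matrix_def C_def cone_def block_def
    by (cases i) (auto intro!: homogeneous_minus)
qed

lemma range_bd_map_cone:
  "range (bd_map (cone d E E' \<Psi>) i) = {bd_map (cone d E E' \<Psi>) i (join (rk E (Suc i)) f g) | f g. True}"
proof -
  have "\<exists>f g. bd_map (cone d E E' \<Psi>) i h = bd_map (cone d E E' \<Psi>) i (join (rk E (Suc i)) f g)" for h
  proof -
    obtain f g where "truncate (rk (cone d E E' \<Psi>) (Suc i)) h = join (rk E (Suc i)) f g"
      by (rule free_mod_joinE[of "truncate (rk (cone d E E' \<Psi>) (Suc i)) h" "rk E (Suc i)" "rk E' i"])
        simp_all
    then show ?thesis
      by (metis bd_map_def mat_map_truncate)
  qed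
  then show ?thesis by blast
qed

text \<open>Multiplication by \<open>p\<close> is an isomorphism from \<open>R/(I : p)\<close> onto \<open>(I + (p))/I\<close>, so the
  kernel of \<open>R/I \<rightarrow> R/(I + (p))\<close> is resolved by \<open>E'\<close>.\<close>

theorem quotient_resolution_cone:
  fixes E E' :: "('v, 'k::field) graded_complex"
  assumes E: "quotient_resolution I E" and E': "quotient_resolution {g. p * g \<in> I} E'"
    and \<Psi>: "chain_map d E' E \<Psi>" "\<Psi> 0 0 0 = p"
  shows "quotient_resolution {f + p * g | f g. f \<in> I} (cone d E E' \<Psi>)"
proof -
  let ?C = "cone d E E' \<Psi>" and ?\<psi> = "degreewise_map E' E \<Psi>"
  note rk0 = quotient_resolution_rk_shift_0[OF E] quotient_resolution_rk_shift_0[OF E']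
  have chain: "?\<psi> i (bd_map E' i g) = bd_map E i (?\<psi> (Suc i) g)" for i g
    using \<Psi>(1) by (simp add: chain_map_def)
  \<comment> \<open>Both modules in degree 0 are \<open>R\<close>, so this component of the chain
    map is multiplication by \<open>p\<close>.\<close>
  have \<psi>0: "?\<psi> 0 g = (\<lambda>a. if a = 0 then p * g 0 else 0)" for g
    using rk0 \<Psi>(2) by (auto simp: degreewise_map_def mat_map_def fun_eq_iff)
  have \<psi>_minus: "?\<psi> i (- g) = - ?\<psi> i g" for i g
    by (simp add: degreewise_map_def mat_map_minus)
  have range_0: "range (bd_map ?C 0) = {h \<in> free_mod 1. h 0 \<in> {f + p * g | f g. f \<in> I}}" (is "_ = ?R")
  proof (intro subset_antisym subsetI)
    fix h assume "h \<in> range (bd_map ?C 0)"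
    then obtain f g where h: "h = bd_map E 0 f + ?\<psi> 0 g"
      unfolding range_bd_map_cone by (auto simp: bd_map_cone_0)
    have "bd_map E 0 f \<in> free_mod 1" "bd_map E 0 f 0 \<in> I"
      using quotient_resolution_range_0[OF E] by blast+
    then show "h \<in> ?R"
      by (auto simp: h \<psi>0 free_mod_def)
  next
    fix h assume "h \<in> ?R"
    then obtain f g where h: "h \<in> free_mod 1" "h 0 = f + p * g" "f \<in> I" by blast
    then have "(\<lambda>a. if a = 0 then f else 0) \<in> range (bd_map E 0)"
      using quotient_resolution_range_0[OF E] by (simp add: free_mod_def)
    then obtain f' where f': "bd_map E 0 f' = (\<lambda>a. if a = 0 then f else 0)" by force
    have "h = bd_map ?C 0 (join (rk E (Suc 0)) f' (\<lambda>_. g))"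
      using h by (auto simp: bd_map_cone_0 f' \<psi>0 free_mod_def fun_eq_iff)
    then show "h \<in> range (bd_map ?C 0)" by blast
  qed
  have complex: "bd_map ?C i (bd_map ?C (Suc i) (join (rk E (Suc (Suc i))) f g)) = 0" for i f g
    using quotient_resolution_complex[OF E] quotient_resolution_complex[OF E']
    by (cases i) (simp_all add: bd_map_cone_0 bd_map_cone_Suc bd_map_linear \<psi>_minus chain)
  have exact: "h \<in> range (bd_map ?C (Suc i))"
    if h: "h \<in> free_mod (rk ?C (Suc i))" "bd_map ?C i h = 0" for h i
  proof -
    obtain f g where fg: "h = join (rk E (Suc i)) f g" "f \<in> free_mod (rk E (Suc i))" "g \<in> free_mod (rk E' i)"
      using free_mod_joinE h(1) by (metis rk_cone(2))
    have zero: "bd_map E i f + ?\<psi> i g = 0 \<and> (\<forall>k. i = Suc k \<longrightarrow> bd_map E' k g = 0)"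
    proof (cases i)
      case 0
      then show ?thesis using h(2) fg(1) by (simp add: bd_map_cone_0)
    next
      case (Suc k)
      have "join (rk E i) (bd_map E i f + ?\<psi> i g) (- bd_map E' k g) = join (rk E i) 0 0"
        using h(2) fg(1) by (simp add: Suc bd_map_cone_Suc)
      then show ?thesis
        by (subst (asm) join_eq_iff) (auto simp: Suc)
    qed
    \<comment> \<open>The diagram chase starts in the second component. For \<open>i = 0\<close> the
      cycle condition says that \<open>p * g 0\<close> lies in \<open>I\<close>, i.e. that
      \<open>g 0\<close> lies in the colon ideal resolved by \<open>E'\<close>.\<close>
    have "g \<in> range (bd_map E' i)"
    proof (cases i)
      case 0
      have "p * g 0 = bd_map E 0 (- f) 0"
        using fun_cong[OF conjunct1[OF zero], of 0]
        by (simp add: 0 \<psi>0 bd_map_linear add_eq_0_iff)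
      moreover have "bd_map E 0 (- f) 0 \<in> I"
        using quotient_resolution_range_0[OF E] by blast
      ultimately show ?thesis
        using quotient_resolution_range_0[OF E'] fg(3) rk0 by (simp add: 0)
    next
      case (Suc k)
      then show ?thesis
        using quotient_resolution_exact[OF E'] fg(3) zero by blast
    qed
    then obtain z where z: "g = bd_map E' i z" by blast
    \<comment> \<open>Replacing \<open>g\<close> by the boundary of \<open>z\<close> turns the first
      component of the cycle condition into a cycle condition in \<open>E\<close>.\<close>
    have "bd_map E i (f + ?\<psi> (Suc i) z) = 0"
      using zero by (simp add: bd_map_linear z chain)
    then obtain y where y: "f + ?\<psi> (Suc i) z = bd_map E (Suc i) y"
      using quotient_resolution_exact[OF E, of "f + ?\<psi> (Suc i) z" i] fg(2) by auto
    \<comment> \<open>The sign of \<open>z\<close> compensates the minus sign in the lower block of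
      the cone differential.\<close>
    have "h = bd_map ?C (Suc i) (join (rk E (Suc (Suc i))) y (- z))"
      by (simp add: bd_map_cone_Suc bd_map_linear \<psi>_minus fg(1) z y[symmetric])
    then show ?thesis by blast
  qed
  have "bd_map ?C i h = 0" if "h \<in> range (bd_map ?C (Suc i))" for i h
    using that complex unfolding range_bd_map_cone by blast
  then have "{h \<in> free_mod (rk ?C (Suc i)). bd_map ?C i h = 0} = range (bd_map ?C (Suc i))" for i
    using exact[of _ i] bd_map_free_mod[of ?C "Suc i"] by blast
  moreover have "shift ?C 0 0 = 0" "rk ?C 0 = 1"
    using rk0 by (simp_all add: cone_def)
  ultimately show ?thesis
    unfolding quotient_resolution_def using homogeneous_matrix_cone[OF E E' \<Psi>(1)] range_0 by blast
qed

lemma fun_space_dim_mono: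
  fixes V W :: "(nat \<Rightarrow> 'k::field) set"
  assumes "V \<subseteq> W" "W \<subseteq> free_mod r"
  shows "fun_space.dim V \<le> fun_space.dim W"
proof -
  obtain B where B: "B \<subseteq> W" "fun_space.independent B" "W \<subseteq> fun_space.span B" "card B = fun_space.dim W"
    using fun_space.basis_exists by blast
  obtain S :: "(nat \<Rightarrow> 'k) set" where S: "finite S" "free_mod r \<subseteq> fun_space.span S"
    using free_mod_finite_span by blast
  have "finite B"
    using fun_space.independent_span_bound[OF S(1) B(2)] B(1) assms(2) S(2) by blast
  then have "fun_space.dim V \<le> card B"
    using B(3) assms(1) by (intro fun_space.dim_le_card) auto
  then show ?thesis
    using B(4) by simp
qed

lemma tensor_part_cone:
  "tensor_part (cone d E E' \<Psi>) (Suc i) j =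
     {join (rk E (Suc i)) f g | f g. f \<in> tensor_part E (Suc i) j \<and> g \<in> tensor_part E' i (j - d)}"
    (is "_ = ?R")
proof (intro subset_antisym subsetI)
  fix h assume h: "h \<in> tensor_part (cone d E E' \<Psi>) (Suc i) j"
  then obtain f g where fg: "h = join (rk E (Suc i)) f g"
      "f \<in> free_mod (rk E (Suc i))" "g \<in> free_mod (rk E' i)"
    using free_mod_joinE[of h "rk E (Suc i)" "rk E' i"] by (auto simp: tensor_part_def)
  have van: "h b = 0" if "b < rk E (Suc i) + rk E' i" "shift (cone d E E' \<Psi>) (Suc i) b \<noteq> j" for b
    using h that by (simp add: tensor_part_def)
  have "f b = 0" if "b < rk E (Suc i)" "shift E (Suc i) b \<noteq> j" for b
    using van[of b] that by (simp add: fg(1) join_def cone_def)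
  moreover have "g b = 0" if "b < rk E' i" "shift E' i b \<noteq> j - d" for b
    using van[of "rk E (Suc i) + b"] that by (simp add: fg(1) join_def cone_def)
  ultimately show "h \<in> ?R"
    using fg by (auto simp: tensor_part_def)
next
  fix h assume "h \<in> ?R"
  then show "h \<in> tensor_part (cone d E E' \<Psi>) (Suc i) j"
    by (auto simp: tensor_part_def join_free_mod) (auto simp: join_def cone_def)
qed

text \<open>With all residues of \<open>\<Psi>\<close> zero, the cone differential over
  \<open>k\<close> is the direct sum of the two differentials, the second up to sign. Cycles and
  boundaries both split accordingly.\<close>

theorem tor_dim_cone:
  fixes E E' :: "('v, 'k::field) graded_complex"
  assumes E: "quotient_resolution I E" and E': "quotient_resolution J E'"
    and res: "\<And>i a b. Poly_Mapping.lookup (\<Psi> i a b) 0 = 0"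
  shows "tor_dim (cone d E E' \<Psi>) (Suc i) j = tor_dim E (Suc i) j + tor_dim E' i (j - d)"
proof -
  let ?C = "cone d E E' \<Psi>"
  have residue_block: "(\<lambda>a b. Poly_Mapping.lookup (block r s A B D a b) 0) =
      block r s (\<lambda>a b. Poly_Mapping.lookup (A a b) 0) (\<lambda>a b. Poly_Mapping.lookup (B a b) 0)
        (\<lambda>a b. Poly_Mapping.lookup (D a b) 0)" for r s and A B D :: "nat \<Rightarrow> nat \<Rightarrow> ('v, 'k) mpoly"
    by (auto simp: block_def fun_eq_iff)
  have zero: "mat_map r s (\<lambda>a b. 0) g = 0" "mat_map 0 s M g = 0" for r s g and M :: "nat \<Rightarrow> nat \<Rightarrow> 'k"
    by (auto simp: mat_map_def fun_eq_iff)
  have bd_0: "tensor_bd ?C 0 (join (rk E (Suc 0)) f g) = tensor_bd E 0 f" for f g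
    using mat_map_block[of "rk E 0" 0 "rk E (Suc 0)" "rk E' 0"
        "\<lambda>a b. Poly_Mapping.lookup (bd E 0 a b) 0" "\<lambda>_ _. 0" "\<lambda>_ _. 0" f g]
    by (simp add: tensor_bd_def cone_def residue_block res zero join_0_right)
  have bd_Suc: "tensor_bd ?C (Suc i) (join (rk E (Suc (Suc i))) f g) =
      join (rk E (Suc i)) (tensor_bd E (Suc i) f) (- tensor_bd E' i g)" for i f g
    by (simp add: tensor_bd_def cone_def residue_block res zero mat_map_block)
  have neg: "- c \<in> tensor_part E' i j" if "c \<in> tensor_part E' i j" for c i j
    using that by (auto simp: tensor_part_def)
  have bd_neg: "tensor_bd E' i (- c) = - tensor_bd E' i c" for i c
    by (simp add: tensor_bd_def mat_map_minus)
  have free: "tor_cycles E (Suc i) j \<subseteq> free_mod (rk E (Suc i))" "tor_cycles E' i (j - d) \<subseteq> free_mod (rk E' i)"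
    by (auto simp: tor_cycles_def tensor_part_def)
  have b_free: "tor_boundaries E (Suc i) j \<subseteq> free_mod (rk E (Suc i))"
      "tor_boundaries E' i (j - d) \<subseteq> free_mod (rk E' i)"
    using tor_boundaries_subset_cycles[OF E, of "Suc i" j] tor_boundaries_subset_cycles[OF E', of i "j - d"]
      free by (simp_all only: subset_trans)
  have "tor_cycles ?C (Suc i) j =
      {join (rk E (Suc i)) f g | f g. f \<in> tor_cycles E (Suc i) j \<and> g \<in> tor_cycles E' i (j - d)}"
  proof -
    have "tensor_bd ?C i (join (rk E (Suc i)) f g) = 0 \<longleftrightarrow>
        tensor_bd E i f = 0 \<and> (\<forall>h. i = Suc h \<longrightarrow> tensor_bd E' h g = 0)" for f g
    proof (cases i)
      case (Suc h)
      have "tensor_bd E (Suc h) f \<in> free_mod (rk E (Suc h))"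
        by (simp add: tensor_bd_def)
      then have "join (rk E (Suc h)) (tensor_bd E (Suc h) f) (- tensor_bd E' h g) = 0 \<longleftrightarrow>
          tensor_bd E (Suc h) f = 0 \<and> - tensor_bd E' h g = 0"
        using join_eq_iff[of "tensor_bd E (Suc h) f" "rk E (Suc h)" 0 "- tensor_bd E' h g" 0]
        by (simp del: neg_equal_0_iff_equal)
      moreover have "- tensor_bd E' h g = 0 \<longleftrightarrow> tensor_bd E' h g = 0"
        by (auto simp: fun_eq_iff)
      ultimately have "join (rk E (Suc h)) (tensor_bd E (Suc h) f) (- tensor_bd E' h g) = 0 \<longleftrightarrow>
          tensor_bd E (Suc h) f = 0 \<and> tensor_bd E' h g = 0"
        by simp
      then show ?thesis
        by (simp add: Suc bd_Suc)
    qed (simp add: bd_0)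
    then show ?thesis
      unfolding tor_cycles_Suc tor_cycles_def[of E'] tensor_part_cone by blast
  qed
  then have cycles: "fun_space.dim (tor_cycles ?C (Suc i) j) =
      fun_space.dim (tor_cycles E (Suc i) j) + fun_space.dim (tor_cycles E' i (j - d))"
    using dim_join[OF subspace_tor_cycles free(1) subspace_tor_cycles free(2)] by simp
  have "tor_boundaries ?C (Suc i) j =
      {join (rk E (Suc i)) f g | f g. f \<in> tor_boundaries E (Suc i) j \<and> g \<in> tor_boundaries E' i (j - d)}"
    (is "?L = ?R")
  proof (intro subset_antisym subsetI)
    fix h assume "h \<in> ?L"
    then obtain f g where "f \<in> tensor_part E (Suc (Suc i)) j" "g \<in> tensor_part E' (Suc i) (j - d)"
        "h = join (rk E (Suc i)) (tensor_bd E (Suc i) f) (tensor_bd E' i (- g))"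
      by (auto simp: tor_boundaries_def tensor_part_cone bd_Suc bd_neg)
    then show "h \<in> ?R"
      using neg unfolding tor_boundaries_def by blast
  next
    fix h assume "h \<in> ?R"
    then obtain f g where fg: "f \<in> tensor_part E (Suc (Suc i)) j" "g \<in> tensor_part E' (Suc i) (j - d)"
        "h = join (rk E (Suc i)) (tensor_bd E (Suc i) f) (tensor_bd E' i g)"
      by (auto simp: tor_boundaries_def)
    then have "h = tensor_bd ?C (Suc i) (join (rk E (Suc (Suc i))) f (- g))"
      by (simp add: bd_Suc bd_neg)
    then show "h \<in> ?L"
      using fg neg unfolding tor_boundaries_def tensor_part_cone by blast
  qed
  then have boundaries: "fun_space.dim (tor_boundaries ?C (Suc i) j) =
      fun_space.dim (tor_boundaries E (Suc i) j) + fun_space.dim (tor_boundaries E' i (j - d))"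
    using dim_join[OF subspace_tor_boundaries b_free(1) subspace_tor_boundaries b_free(2)] by simp
  \<comment> \<open>These bounds are needed because \<open>tor_dim\<close> subtracts natural
    numbers; only without truncation is a difference of sums the sum of the differences.\<close>
  have "fun_space.dim (tor_boundaries E (Suc i) j) \<le> fun_space.dim (tor_cycles E (Suc i) j)"
      "fun_space.dim (tor_boundaries E' i (j - d)) \<le> fun_space.dim (tor_cycles E' i (j - d))"
    by (rule fun_space_dim_mono[OF tor_boundaries_subset_cycles[OF E] free(1)],
        rule fun_space_dim_mono[OF tor_boundaries_subset_cycles[OF E'] free(2)])
  with cycles boundaries show ?thesis
    by (simp add: tor_dim_def)
qed

section \<open>Monomial ideals\<close>

text \<open>\<open>U\<close> lists the exponents of all monomials allowed, not of generators. The
  set is an ideal when \<open>U\<close> is closed under adding exponents, as unions of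
  \<open>multiples\<close> are.\<close>

definition monomial_ideal :: "('v \<Rightarrow>\<^sub>0 nat) set \<Rightarrow> ('v, 'k::field) mpoly set" where
  "monomial_ideal U = {p. Poly_Mapping.keys p \<subseteq> U}"

definition multiples :: "('v \<Rightarrow>\<^sub>0 nat) \<Rightarrow> ('v \<Rightarrow>\<^sub>0 nat) set" where
  "multiples a = range ((+) a)"

lemma mem_multiples_iff:
  "m \<in> multiples a \<longleftrightarrow> (\<forall>x. Poly_Mapping.lookup a x \<le> Poly_Mapping.lookup m x)"
proof
  assume "\<forall>x. Poly_Mapping.lookup a x \<le> Poly_Mapping.lookup m x"
  then have "m = a + (m - a)"
    by (intro poly_mapping_eqI) (simp add: lookup_add lookup_minus)
  then show "m \<in> multiples a"
    unfolding multiples_def by blast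
qed (auto simp: multiples_def lookup_add)

lemma poly_mapping_sum_singles:
  "(\<Sum>m \<in> Poly_Mapping.keys p. Poly_Mapping.single m (Poly_Mapping.lookup p m)) = p"
  by (rule poly_mapping_eqI)
    (simp add: lookup_sum lookup_single when_def in_keys_iff if_distrib cong: if_cong)

lemma lookup_single_mult:
  "Poly_Mapping.lookup (Poly_Mapping.single a c * p) (a + m) = c * Poly_Mapping.lookup p m"
  for p :: "('v, 'k::field) mpoly"
  by (simp add: lookup_mult lookup_single when_mult)

lemma keys_single_mult:
  "Poly_Mapping.keys (Poly_Mapping.single a 1 * p) = (+) a ` Poly_Mapping.keys p"
  for p :: "('v, 'k::field) mpoly"
proof (intro subset_antisym subsetI)
  fix m assume "m \<in> Poly_Mapping.keys (Poly_Mapping.single a 1 * p)"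
  then show "m \<in> (+) a ` Poly_Mapping.keys p"
    using keys_mult[of "Poly_Mapping.single a 1" p] by auto
qed (auto simp: in_keys_iff lookup_single_mult)

text \<open>Multiplication by a monomial translates the support without cancellation, so the colon
  by a monomial can be computed on exponents.\<close>

lemma monomial_ideal_colon:
  "Poly_Mapping.single a 1 * p \<in> monomial_ideal U \<longleftrightarrow> p \<in> monomial_ideal {c. a + c \<in> U}"
  for p :: "('v, 'k::field) mpoly"
  by (auto simp: monomial_ideal_def keys_single_mult)

lemma multiple_of_monomial:
  assumes "Poly_Mapping.keys p \<subseteq> multiples a"
  shows "\<exists>q :: ('v, 'k::field) mpoly. p = Poly_Mapping.single a 1 * q"
proof
  let ?q = "\<Sum>m \<in> Poly_Mapping.keys p. Poly_Mapping.single (m - a) (Poly_Mapping.lookup p m)"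
  have "a + (m - a) = m" if "m \<in> Poly_Mapping.keys p" for m
    using assms that by (auto simp: multiples_def)
  then have "Poly_Mapping.single a 1 * ?q =
      (\<Sum>m \<in> Poly_Mapping.keys p. Poly_Mapping.single m (Poly_Mapping.lookup p m))"
    by (simp add: sum_distrib_left mult_single)
  then show "p = Poly_Mapping.single a 1 * ?q"
    by (simp add: poly_mapping_sum_singles)
qed

lemma monomial_ideal_Un_multiples:
  "{f + Poly_Mapping.single a 1 * g | f g. f \<in> monomial_ideal U} =
     (monomial_ideal (U \<union> multiples a) :: ('v, 'k::field) mpoly set)"
proof (intro subset_antisym subsetI)
  fix p :: "('v, 'k) mpoly"
  assume "p \<in> {f + Poly_Mapping.single a 1 * g | f g. f \<in> monomial_ideal U}"
  then obtain f g where p: "p = f + Poly_Mapping.single a 1 * g" "f \<in> monomial_ideal U"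
    by blast
  then show "p \<in> monomial_ideal (U \<union> multiples a)"
    using keys_add[of f "Poly_Mapping.single a 1 * g"]
    by (auto simp: monomial_ideal_def keys_single_mult multiples_def)
next
  fix p :: "('v, 'k) mpoly"
  assume p: "p \<in> monomial_ideal (U \<union> multiples a)"
  \<comment> \<open>The terms outside \<open>U\<close> all have exponents in
    \<open>multiples a\<close>, so their sum is divisible by the monomial.\<close>
  let ?f = "terms_part (\<lambda>m. m \<in> U) p" and ?h = "terms_part (\<lambda>m. m \<notin> U) p"
  have "Poly_Mapping.keys ?h \<subseteq> multiples a"
    using p by (auto simp: monomial_ideal_def keys_terms_part)
  then obtain q where "?h = Poly_Mapping.single a 1 * q"
    using multiple_of_monomial by blast
  moreover have "p = ?f + ?h" "?f \<in> monomial_ideal U"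
    by (rule terms_part_compl) (auto simp: monomial_ideal_def keys_terms_part)
  ultimately show "p \<in> {f + Poly_Mapping.single a 1 * g | f g. f \<in> monomial_ideal U}"
    by (metis (mono_tags, lifting) mem_Collect_eq)
qed

lemma quotient_resolution_monomial_cone:
  fixes E E' :: "('v, 'k::field) graded_complex"
  assumes "quotient_resolution (monomial_ideal U) E"
    and "quotient_resolution (monomial_ideal {c. a + c \<in> U}) E'"
    and "chain_map d E' E \<Psi>" "\<Psi> 0 0 0 = Poly_Mapping.single a 1"
  shows "quotient_resolution (monomial_ideal (U \<union> multiples a)) (cone d E E' \<Psi>)"
  using quotient_resolution_cone[of "monomial_ideal U" E "Poly_Mapping.single a 1" E' d \<Psi>] assms
  unfolding monomial_ideal_colon monomial_ideal_Un_multiples Collect_mem_eq by blast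

text \<open>Subtraction of exponents truncates at 0 in each variable, so \<open>g - a\<close> is the
  exponent of \<open>x^g / gcd(x^g, x^a)\<close>, the usual generator of the colon ideal.\<close>

lemma colon_multiples: "{c. a + c \<in> (\<Union>g\<in>M. multiples g)} = (\<Union>g\<in>(\<lambda>g. g - a) ` M. multiples g)"
  by (rule set_eqI) (simp add: mem_multiples_iff lookup_add lookup_minus le_diff_conv add.commute)

text \<open>For the zero ideal, \<open>R\<close> in degree 0 is already a resolution.\<close>

lemma quotient_resolution_empty:
  "\<exists>E :: ('v, 'k::field) graded_complex. quotient_resolution (monomial_ideal {}) E"
proof
  let ?E = "\<lparr>rk = \<lambda>i. if i = 0 then 1 else 0, shift = \<lambda>_ _. 0, aug = \<lambda>_. 0, bd = \<lambda>_ _ _. 0\<rparr>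
      :: ('v, 'k) graded_complex"
  have "bd_map ?E i = (\<lambda>_. 0)" for i
    by (auto simp: bd_map_def mat_map_def fun_eq_iff)
  moreover have "f = 0" if "f \<in> free_mod (Suc 0)" "f 0 = 0" for f :: "nat \<Rightarrow> ('v, 'k) mpoly"
  proof
    show "f b = 0 b" for b
      using that by (cases b) (auto simp: free_mod_def)
  qed
  moreover have "free_mod 0 = {0 :: nat \<Rightarrow> ('v, 'k) mpoly}"
    by (auto simp: free_mod_def)
  ultimately show "quotient_resolution (monomial_ideal {}) ?E"
    by (auto simp: quotient_resolution_def homogeneous_matrix_def monomial_ideal_def)
qed

text \<open>Remove a generator \<open>a\<close> and take the cone. The induction is on a bound for
  the number of generators: the colon ideal is generated by the \<open>g - a\<close>, which need not
  belong to the original set but are no more numerous than the remaining generators.\<close>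

theorem monomial_quotient_resolution_exists:
  assumes "finite M"
  shows "\<exists>E :: ('v, 'k::field) graded_complex. quotient_resolution (monomial_ideal (\<Union>g\<in>M. multiples g)) E"
proof -
  have "\<exists>E :: ('v, 'k) graded_complex. quotient_resolution (monomial_ideal (\<Union>g\<in>M. multiples g)) E"
    if "finite M" "card M \<le> n" for n and M :: "('v \<Rightarrow>\<^sub>0 nat) set"
    using that
  proof (induction n arbitrary: M)
    case 0
    then show ?case using quotient_resolution_empty by simp
  next
    case (Suc n)
    show ?case
    proof (cases "M = {}")
      case True
      then show ?thesis using quotient_resolution_empty by simp
    next
      case False
      then obtain a M' where M': "M = insert a M'" "a \<notin> M'"
        by (meson Set.set_insert ex_in_conv)
      let ?U = "\<Union>g\<in>M'. multiples g"
      have card: "finite M'" "card M' \<le> n"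
        using Suc.prems M' by auto
      then obtain E :: "('v, 'k) graded_complex" where E: "quotient_resolution (monomial_ideal ?U) E"
        using Suc.IH by blast
      have "card ((\<lambda>g. g - a) ` M') \<le> n"
        using card card_image_le order_trans by blast
      then obtain E' :: "('v, 'k) graded_complex" where
        E': "quotient_resolution (monomial_ideal {c. a + c \<in> ?U}) E'"
        using Suc.IH[of "(\<lambda>g. g - a) ` M'"] card by (auto simp only: colon_multiples)
      obtain \<Psi> where \<Psi>: "chain_map (int (monomial_degree a)) E' E \<Psi>" "\<Psi> 0 0 0 = Poly_Mapping.single a 1"
        by (rule chain_map_exists[OF E' E homogeneous_single[of a 1]])
          (simp_all only: monomial_ideal_colon)
      have "?U \<union> multiples a = (\<Union>g\<in>M. multiples g)"
        by (auto simp: M')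
      then show ?thesis
        using quotient_resolution_monomial_cone[OF E E' \<Psi>] by auto
    qed
  qed
  then show ?thesis using assms by blast
qed

text \<open>Since \<open>z * x\<^sup>b\<close> is divisible by the variable \<open>z\<close> and \<open>x\<^sup>b\<close> already maps
  \<open>I : z * x\<^sup>b\<close> into \<open>I\<close>, the comparison map in the cone can be taken divisible by \<open>z\<close>. It
  vanishes after tensoring with the residue field.\<close>

theorem graded_betti_add_monomial:
  fixes U :: "('v::finite \<Rightarrow>\<^sub>0 nat) set"
  assumes U: "finite M" "U = (\<Union>g\<in>M. multiples g)"
    and a: "a = Poly_Mapping.single z 1 + b" and b: "\<And>c. a + c \<in> U \<Longrightarrow> b + c \<in> U"
    and proper: "a \<notin> U"
  shows "graded_betti (monomial_ideal (U \<union> multiples a) :: ('v, 'k::field) mpoly set) i j =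
    graded_betti (monomial_ideal U :: ('v, 'k) mpoly set) i j +
    graded_betti (monomial_ideal {c. a + c \<in> U} :: ('v, 'k) mpoly set) (i - 1) (j - int (monomial_degree a))"
proof (cases "0 \<le> i")
  case True
  \<comment> \<open>Index \<open>i\<close> of the ideal is homological degree \<open>Suc h\<close>
    of the quotient ring, and index \<open>i - 1\<close> is degree \<open>h\<close>; the case
    \<open>h = 0\<close> reaches the convention at -1.\<close>
  then obtain h where h: "i = int (Suc h) - 1"
    by (metis add_diff_cancel_right' nonneg_int_cases of_nat_Suc add.commute)
  let ?J = "{c. a + c \<in> U}" and ?z = "Poly_Mapping.single (Poly_Mapping.single z 1) 1 :: ('v, 'k) mpoly"
  let ?d = "int (monomial_degree a)"
  obtain E :: "('v, 'k) graded_complex" where E: "quotient_resolution (monomial_ideal U) E"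
    using monomial_quotient_resolution_exists U by blast
  obtain E' :: "('v, 'k) graded_complex" where E': "quotient_resolution (monomial_ideal ?J) E'"
    using monomial_quotient_resolution_exists[of "(\<lambda>g. g - a) ` M"] U by (auto simp only: colon_multiples finite_imageI)
  have "Poly_Mapping.single b 1 * p \<in> (monomial_ideal U :: ('v, 'k) mpoly set)" if "p \<in> monomial_ideal ?J" for p
    using that b by (auto simp: monomial_ideal_def keys_single_mult)
  then obtain \<Phi> where \<Phi>: "chain_map (int (monomial_degree b)) E' E \<Phi>" "\<Phi> 0 0 0 = Poly_Mapping.single b 1"
    by (rule chain_map_exists[OF E' E homogeneous_single[of b 1]]) auto
  define \<Psi> where "\<Psi> i r s = ?z * \<Phi> i r s" for i r s
  have \<Psi>_map: "degreewise_map E' E \<Psi> i g = (\<lambda>r. ?z * degreewise_map E' E \<Phi> i g r)" for i g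
    by (auto simp: degreewise_map_def mat_map_def \<Psi>_def sum_distrib_left mult.assoc)
  have "bd_map E i (\<lambda>r. ?z * f r) = (\<lambda>r. ?z * bd_map E i f r)" for i f
    by (auto simp: bd_map_def mat_map_def sum_distrib_left mult.left_commute)
  then have "degreewise_map E' E \<Psi> i (bd_map E' i g) = bd_map E i (degreewise_map E' E \<Psi> (Suc i) g)" for i g
    using \<Phi>(1) by (simp add: \<Psi>_map chain_map_def)
  moreover have "homogeneous (shift E' i s + ?d - shift E i r) (\<Psi> i r s)" if "r < rk E i" "s < rk E' i" for i r s
  proof -
    have "homogeneous (shift E' i s + int (monomial_degree b) - shift E i r) (\<Phi> i r s)"
      using \<Phi>(1) that by (auto simp: chain_map_def homogeneous_matrix_def)
    then show ?thesis
      using homogeneous_mult[OF homogeneous_single[of "Poly_Mapping.single z 1" 1],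
          of "shift E' i s + int (monomial_degree b) - shift E i r" "\<Phi> i r s"]
      by (simp add: \<Psi>_def a monomial_degree_add algebra_simps)
  qed
  ultimately have \<Psi>: "chain_map ?d E' E \<Psi>"
    by (simp add: chain_map_def homogeneous_matrix_def)
  have cone: "quotient_resolution (monomial_ideal (U \<union> multiples a)) (cone ?d E E' \<Psi>)"
    by (rule quotient_resolution_monomial_cone[OF E E' \<Psi>]) (simp add: \<Psi>_def \<Phi>(2) mult_single a)
  \<comment> \<open>If the monomial 1 were in the ideal, then so would be \<open>x^a\<close>. The
    same kind of argument keeps constant terms out of all three ideals, as
    \<open>graded_betti_eq_tor_dim\<close> requires.\<close>
  have 0: "(0 :: 'v \<Rightarrow>\<^sub>0 nat) \<notin> U"
  proof
    assume "0 \<in> U"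
    then obtain g where "g \<in> M" "0 \<in> multiples g"
      using U(2) by blast
    then have "a \<in> multiples g"
      by (simp add: mem_multiples_iff)
    with \<open>g \<in> M\<close> proper U(2) show False by blast
  qed
  have "monomial_degree a \<noteq> 0"
    by (simp add: a monomial_degree_add)
  have a0: "0 \<notin> multiples a"
  proof
    assume "0 \<in> multiples a"
    then obtain c where "a + c = 0"
      unfolding multiples_def by (metis rangeE)
    with \<open>monomial_degree a \<noteq> 0\<close> show False
      by (simp add: exponent_add_eq_0_iff)
  qed
  have const: "Poly_Mapping.lookup p 0 = 0" if "0 \<notin> V" "p \<in> monomial_ideal V"
    for p :: "('v, 'k) mpoly" and V
    using that by (auto simp: monomial_ideal_def in_keys_iff)
  have "graded_betti (monomial_ideal (U \<union> multiples a) :: ('v, 'k) mpoly set) i j =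
      tor_dim (cone ?d E E' \<Psi>) (Suc h) j"
    unfolding h by (rule graded_betti_eq_tor_dim[OF cone const]) (use 0 a0 in auto)
  also have "\<dots> = tor_dim E (Suc h) j + tor_dim E' h (j - ?d)"
  proof (rule tor_dim_cone[OF E E'])
    have "Poly_Mapping.single z 1 \<noteq> (0 :: 'v \<Rightarrow>\<^sub>0 nat)"
      by (metis monomial_degree_single monomial_degree_zero one_neq_zero)
    then show "Poly_Mapping.lookup (\<Psi> i r s) 0 = 0" for i r s
      by (simp add: \<Psi>_def constant_coeff_mult lookup_single when_def)
  qed
  also have "tor_dim E (Suc h) j = graded_betti (monomial_ideal U :: ('v, 'k) mpoly set) i j"
    unfolding h by (rule graded_betti_eq_tor_dim[OF E const, symmetric]) (use 0 in auto)
  also have "tor_dim E' h (j - ?d) = graded_betti (monomial_ideal ?J :: ('v, 'k) mpoly set) (i - 1) (j - ?d)"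
  proof -
    have "i - 1 = int h - 1"
      using h by simp
    moreover have "graded_betti (monomial_ideal ?J :: ('v, 'k) mpoly set) (int h - 1) (j - ?d) = tor_dim E' h (j - ?d)"
      by (rule graded_betti_eq_tor_dim[OF E' const]) (use proper in auto)
    ultimately show ?thesis
      by simp
  qed
  finally show ?thesis .
\<comment> \<open>For negative \<open>i\<close> the identity is pure convention: at -1 the two
  unshifted values agree, and the shifted one has index -2 and vanishes.\<close>
qed (simp add: graded_betti_def)

section \<open>Edge ideals\<close>

definition edge_exponents :: "'v graph \<Rightarrow> ('v \<Rightarrow>\<^sub>0 nat) set" where
  "edge_exponents G = {Poly_Mapping.single x 1 + Poly_Mapping.single y 1 | x y. {x, y} \<in> edges G}"

definition edge_multiples :: "'v graph \<Rightarrow> ('v \<Rightarrow>\<^sub>0 nat) set" where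
  "edge_multiples G = (\<Union>g\<in>edge_exponents G. multiples g)"

lemma finite_edge_exponents: "finite (edge_exponents G)" for G :: "'v::finite graph"
proof -
  have "edge_exponents G \<subseteq> (\<lambda>(x, y). Poly_Mapping.single x 1 + Poly_Mapping.single y 1) ` UNIV"
    by (auto simp: edge_exponents_def)
  then show ?thesis
    by (rule finite_subset) simp
qed

text \<open>Distinctness matters: for \<open>x = y\<close> divisibility would require exponent
  2.\<close>

lemma mem_multiples_pair_iff:
  assumes "x \<noteq> y"
  shows "m \<in> multiples (Poly_Mapping.single x 1 + Poly_Mapping.single y 1) \<longleftrightarrow>
    1 \<le> Poly_Mapping.lookup m x \<and> 1 \<le> Poly_Mapping.lookup m y"
proof
  assume "m \<in> multiples (Poly_Mapping.single x 1 + Poly_Mapping.single y 1)"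
  then have "Poly_Mapping.lookup (Poly_Mapping.single x 1 + Poly_Mapping.single y 1) z \<le> Poly_Mapping.lookup m z" for z
    by (simp only: mem_multiples_iff)
  from this[of x] this[of y] assms
  show "1 \<le> Poly_Mapping.lookup m x \<and> 1 \<le> Poly_Mapping.lookup m y"
    by (simp add: lookup_add lookup_single when_def)
next
  assume "1 \<le> Poly_Mapping.lookup m x \<and> 1 \<le> Poly_Mapping.lookup m y"
  then show "m \<in> multiples (Poly_Mapping.single x 1 + Poly_Mapping.single y 1)"
    using assms by (auto simp: mem_multiples_iff lookup_add lookup_single when_def)
qed

text \<open>A monomial lies in the edge ideal exactly when its support contains an edge. This
  reduces the colon computations below to combinatorics of supports.\<close>

lemma mem_edge_multiples_iff:
  assumes "\<And>x. {x} \<notin> edges G"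
  shows "m \<in> edge_multiples G \<longleftrightarrow>
    (\<exists>x y. {x, y} \<in> edges G \<and> 1 \<le> Poly_Mapping.lookup m x \<and> 1 \<le> Poly_Mapping.lookup m y)"
proof -
  have "m \<in> edge_multiples G \<longleftrightarrow> (\<exists>x y. {x, y} \<in> edges G \<and>
      m \<in> multiples (Poly_Mapping.single x 1 + Poly_Mapping.single y 1))"
    unfolding edge_multiples_def edge_exponents_def by blast
  moreover have "x \<noteq> y" if "{x, y} \<in> edges G" for x y
    using assms that by auto
  ultimately show ?thesis
    by (metis mem_multiples_pair_iff)
qed

text \<open>A monomial divisible by an edge is a multiple of a generator, and every polynomial is a
  sum of its terms. Conversely the monomial ideal is a submodule containing the generators.\<close>

lemma edge_ideal_eq_monomial_ideal:
  fixes G :: "'v graph"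
  shows "(edge_ideal G :: ('v, 'k::field) mpoly set) = monomial_ideal (edge_multiples G)"
proof -
  interpret module "(*) :: ('v, 'k::field) mpoly \<Rightarrow> _"
    by (rule module_mpoly)
  let ?S = "{var x * var y | x y. {x, y} \<in> edges G} :: ('v, 'k) mpoly set"
  have var: "var x * var y = (Poly_Mapping.single (Poly_Mapping.single x 1 + Poly_Mapping.single y 1) 1
      :: ('v, 'k) mpoly)" for x y :: 'v
    by (simp add: var_def mult_single)
  have "span ?S = monomial_ideal (edge_multiples G)"
  proof (intro subset_antisym subsetI)
    fix p :: "('v, 'k) mpoly"
    assume p: "p \<in> monomial_ideal (edge_multiples G)"
    have "Poly_Mapping.single m c \<in> span ?S" if m: "m \<in> edge_multiples G" for m c
    proof -
      obtain x y d where "{x, y} \<in> edges G" and m_eq: "m = Poly_Mapping.single x 1 + Poly_Mapping.single y 1 + d"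
        using m by (auto simp: edge_multiples_def edge_exponents_def multiples_def)
      then have "Poly_Mapping.single d c * (var x * var y) \<in> span ?S"
        by (intro span_scale span_base) blast
      then show ?thesis
        by (simp add: var mult_single m_eq add_ac)
    qed
    then have "(\<Sum>m \<in> Poly_Mapping.keys p. Poly_Mapping.single m (Poly_Mapping.lookup p m)) \<in> span ?S"
      using p by (intro span_sum) (auto simp: monomial_ideal_def)
    then show "p \<in> span ?S"
      by (simp add: poly_mapping_sum_singles)
  next
    have "subspace (monomial_ideal (edge_multiples G) :: ('v, 'k) mpoly set)"
      unfolding subspace_def
    proof (intro conjI ballI allI)
      fix p q :: "('v, 'k) mpoly"
      assume "p \<in> monomial_ideal (edge_multiples G)"
      then show "q * p \<in> monomial_ideal (edge_multiples G)"
        using keys_mult[of q p]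
        by (fastforce simp: monomial_ideal_def edge_multiples_def mem_multiples_iff lookup_add intro: trans_le_add2)
      fix r :: "('v, 'k) mpoly"
      assume "r \<in> monomial_ideal (edge_multiples G)"
      then show "p + r \<in> monomial_ideal (edge_multiples G)"
        using \<open>p \<in> _\<close> keys_add[of p r] by (auto simp: monomial_ideal_def)
    qed (simp add: monomial_ideal_def)
    moreover have "?S \<subseteq> monomial_ideal (edge_multiples G)"
      unfolding var by (force simp: monomial_ideal_def edge_multiples_def edge_exponents_def mem_multiples_iff)
    ultimately show "p \<in> monomial_ideal (edge_multiples G)" if "p \<in> span ?S" for p
      using that span_minimal by blast
  qed
  then show ?thesis
    by (simp add: edge_ideal_def)
qed

definition variable_multiples :: "'v set \<Rightarrow> ('v \<Rightarrow>\<^sub>0 nat) set" where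
  "variable_multiples A = (\<Union>x\<in>A. multiples (Poly_Mapping.single x 1))"

lemma mem_variable_multiples_iff:
  "m \<in> variable_multiples A \<longleftrightarrow> (\<exists>x\<in>A. 1 \<le> Poly_Mapping.lookup m x)"
  by (auto simp: variable_multiples_def mem_multiples_iff lookup_single when_def)

text \<open>Pascal's rule in summed form; the second sum is the contribution of the colon ideal,
  shifted by one.\<close>

lemma sum_binomial_Suc:
  fixes F :: "nat \<Rightarrow> nat"
  shows "(\<Sum>l\<le>n. (n choose l) * F l) + (\<Sum>l\<le>n. (n choose l) * F (Suc l)) = (\<Sum>l\<le>Suc n. (Suc n choose l) * F l)"
proof -
  have "(\<Sum>l\<le>n. (n choose l) * F l) = (\<Sum>l\<le>Suc n. (n choose l) * F l)"
    by (simp add: binomial_eq_0)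
  also have "\<dots> = F 0 + (\<Sum>l\<le>n. (n choose Suc l) * F (Suc l))"
    by (subst sum.atMost_Suc_shift) simp
  finally show ?thesis
    using sum.atMost_Suc_shift[of "\<lambda>l. (Suc n choose l) * F l" n]
    by (simp only: binomial_Suc_Suc add_mult_distrib sum.distrib) simp
qed

text \<open>Adjoin the variables of \<open>A\<close> one by one. A new variable \<open>z\<close>
  occurs in no earlier generator, so the colon by \<open>z\<close> changes nothing and each step
  adds a copy of the previous numbers shifted by one in both indices.\<close>

lemma graded_betti_add_variables:
  fixes H :: "'v::finite graph"
  assumes H: "\<And>x. {x} \<notin> edges H" and A: "A \<inter> \<Union>(edges H) = {}"
  shows "graded_betti (monomial_ideal (edge_multiples H \<union> variable_multiples A) :: ('v, 'k::field) mpoly set) i j =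
    (\<Sum>l\<le>card A. (card A choose l) *
      graded_betti (monomial_ideal (edge_multiples H) :: ('v, 'k) mpoly set) (i - int l) (j - int l))"
  using finite[of A] A
proof (induction A arbitrary: i j)
  case empty
  then show ?case by (simp add: variable_multiples_def)
next
  case (insert z A)
  let ?U = "edge_multiples H \<union> variable_multiples A" and ?a = "Poly_Mapping.single z 1 :: 'v \<Rightarrow>\<^sub>0 nat"
  let ?b = "\<lambda>i j. graded_betti (monomial_ideal (edge_multiples H) :: ('v, 'k) mpoly set) i j"
  let ?M = "edge_exponents H \<union> (\<lambda>x. Poly_Mapping.single x 1) ` A"
  have "?a + c \<in> edge_multiples H \<longleftrightarrow> c \<in> edge_multiples H" for c
  proof -
    have "Poly_Mapping.lookup (?a + c) x = Poly_Mapping.lookup c x \<and>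
        Poly_Mapping.lookup (?a + c) y = Poly_Mapping.lookup c y" if "{x, y} \<in> edges H" for x y
    proof -
      have "z \<noteq> x" "z \<noteq> y"
        using insert.prems that by blast+
      then show ?thesis
        by (simp add: lookup_add lookup_single when_def)
    qed
    then show ?thesis
      unfolding mem_edge_multiples_iff[OF H] by (simp cong: conj_cong)
  qed
  moreover have "?a + c \<in> variable_multiples A \<longleftrightarrow> c \<in> variable_multiples A" for c
    using insert.hyps by (auto simp: mem_variable_multiples_iff lookup_add lookup_single when_def)
  ultimately have colon: "?a + c \<in> ?U \<longleftrightarrow> c \<in> ?U" for c
    by blast
  have "0 \<notin> ?U"
    by (simp add: mem_edge_multiples_iff[OF H] mem_variable_multiples_iff)
  then have "?a \<notin> ?U"
    using colon[of 0] by simp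
  moreover have "0 + c \<in> ?U" if "?a + c \<in> ?U" for c
    using that colon by (simp only: add_0_left)
  moreover have "?U = (\<Union>g\<in>?M. multiples g)"
    by (auto simp: edge_multiples_def variable_multiples_def)
  moreover have "finite ?M"
    by (simp add: finite_edge_exponents)
  \<comment> \<open>The factorization of the new generator as a variable times a monomial
    \<open>b\<close>, here with \<open>b = 0\<close>.\<close>
  moreover have "?a = ?a + 0"
    by simp
  ultimately have "graded_betti (monomial_ideal (?U \<union> multiples ?a) :: ('v, 'k) mpoly set) i j =
      graded_betti (monomial_ideal ?U :: ('v, 'k) mpoly set) i j +
      graded_betti (monomial_ideal {c. ?a + c \<in> ?U} :: ('v, 'k) mpoly set) (i - 1) (j - int (monomial_degree ?a))"
    by (intro graded_betti_add_monomial[of ?M _ _ z 0])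
  also have "{c. ?a + c \<in> ?U} = ?U"
    by (simp only: colon Collect_mem_eq)
  finally have "graded_betti (monomial_ideal (?U \<union> multiples ?a) :: ('v, 'k) mpoly set) i j =
      (\<Sum>l\<le>card A. (card A choose l) * ?b (i - int l) (j - int l)) +
      (\<Sum>l\<le>card A. (card A choose l) * ?b (i - int (Suc l)) (j - int (Suc l)))"
    using insert.IH insert.prems by (simp add: algebra_simps)
  also have "\<dots> = (\<Sum>l\<le>Suc (card A). (Suc (card A) choose l) * ?b (i - int l) (j - int l))"
    by (rule sum_binomial_Suc)
  finally show ?case
    using insert.hyps by (simp add: variable_multiples_def Un_ac)
qed

text \<open>Sending a neighbor \<open>y\<close> to the edge \<open>{x, y}\<close> is a bijection
  onto the edges at \<open>x\<close>.\<close>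

lemma card_neighbors:
  assumes "\<And>x. {x} \<notin> edges G" "\<And>e. e \<in> edges G \<Longrightarrow> card e = 2"
  shows "card (neighbors G x) = degree G x"
proof -
  have "inj_on (\<lambda>y. {x, y}) (neighbors G x)"
    by (auto simp: inj_on_def doubleton_eq_iff)
  moreover have "(\<lambda>y. {x, y}) ` neighbors G x = {e \<in> edges G. x \<in> e}"
  proof (intro subset_antisym subsetI)
    fix e assume e: "e \<in> {e \<in> edges G. x \<in> e}"
    then obtain p q where "e = {p, q}"
      using assms(2) by (metis (no_types, lifting) card_2_iff mem_Collect_eq)
    then show "e \<in> (\<lambda>y. {x, y}) ` neighbors G x"
      using e by (auto simp: neighbors_def image_iff insert_commute)
  qed (auto simp: neighbors_def)
  ultimately show ?thesis
    using card_image[of "\<lambda>y. {x, y}" "neighbors G x"] by (simp add: degree_def)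
qed

text \<open>The monomial of the edge \<open>{u, v}\<close> has degree 2, so the cone contributes the
  shift by 1 and 2; the shift by \<open>l\<close> in both indices comes from the variables in
  \<open>W\<close>.\<close>

theorem graded_betti_leaf:
  fixes G :: "'v::finite graph"
  assumes G: "finite_simple_graph G" and uv: "{u, v} \<in> edges G" and deg: "degree G u = 1"
    and N: "neighbors G v = insert u W" "u \<notin> W"
  shows "graded_betti (edge_ideal G :: ('v, 'k::field) mpoly set) i j =
    graded_betti (edge_ideal (delete_verts G {u}) :: ('v, 'k) mpoly set) i j +
    (\<Sum>l\<le>card W. (card W choose l) *
       graded_betti (edge_ideal (delete_verts G ({u, v} \<union> W)) :: ('v, 'k) mpoly set)
         (i - 1 - int l) (j - 2 - int l))"
proof -
  define T where "T = delete_verts G {u}"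
  define H where "H = delete_verts G ({u, v} \<union> W)"
  let ?a = "Poly_Mapping.single u 1 + Poly_Mapping.single v 1 :: 'v \<Rightarrow>\<^sub>0 nat"
  have card2: "card e = 2" if "e \<in> edges G" for e
    using G that by (auto simp: finite_simple_graph_def)
  have noloop: "{x} \<notin> edges G" for x
    using card2[of "{x}"] by auto
  then have noloop': "{x} \<notin> edges T" "{x} \<notin> edges H" for x
    by (auto simp: T_def H_def delete_verts_def)
  have "u \<noteq> v"
    using uv noloop by auto
  have only: "e = {u, v}" if "e \<in> edges G" "u \<in> e" for e
  proof -
    obtain e' where "{e \<in> edges G. u \<in> e} = {e'}"
      using deg by (auto simp: degree_def card_1_singleton_iff)
    moreover have "e \<in> {e \<in> edges G. u \<in> e}" "{u, v} \<in> {e \<in> edges G. u \<in> e}"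
      using that uv by simp_all
    ultimately show ?thesis
      by (simp only: singleton_iff)
  qed
  have T: "{x, y} \<in> edges T \<longleftrightarrow> {x, y} \<in> edges G \<and> x \<noteq> u \<and> y \<noteq> u" for x y
    by (auto simp: T_def delete_verts_def)
  have H: "{x, y} \<in> edges H \<longleftrightarrow> {x, y} \<in> edges G \<and> {x, y} \<inter> ({u, v} \<union> W) = {}" for x y
    by (auto simp: H_def delete_verts_def)
  have vW: "{v, y} \<in> edges G \<longleftrightarrow> y = u \<or> y \<in> W" for y
    using N by (auto simp: neighbors_def)
  have G_eq: "edge_multiples G = edge_multiples T \<union> multiples ?a"
  proof -
    have "{x, y} \<in> edges G \<longleftrightarrow> {x, y} \<in> edges T \<or> {x, y} = {u, v}" for x y
      using only[of "{x, y}"] uv by (auto simp: T)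
    then have "edge_exponents G = insert ?a (edge_exponents T)"
      by (auto simp: edge_exponents_def doubleton_eq_iff add.commute)
    then show ?thesis
      by (auto simp: edge_multiples_def)
  qed
  have T_mem: "m \<in> edge_multiples T \<longleftrightarrow> (\<exists>x y. {x, y} \<in> edges G \<and> x \<noteq> u \<and> y \<noteq> u \<and>
      1 \<le> Poly_Mapping.lookup m x \<and> 1 \<le> Poly_Mapping.lookup m y)" for m
    unfolding mem_edge_multiples_iff[OF noloop'(1)] T by (simp only: conj_assoc)
  have H_mem: "m \<in> edge_multiples H \<longleftrightarrow> (\<exists>x y. {x, y} \<in> edges G \<and> {x, y} \<inter> ({u, v} \<union> W) = {} \<and>
      1 \<le> Poly_Mapping.lookup m x \<and> 1 \<le> Poly_Mapping.lookup m y)" for m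
    unfolding mem_edge_multiples_iff[OF noloop'(2)] H by (simp only: conj_assoc)
  have look: "Poly_Mapping.lookup (?a + c) x = (if x = u \<or> x = v then 1 else 0) + Poly_Mapping.lookup c x" for c x
    using \<open>u \<noteq> v\<close> by (auto simp: lookup_add lookup_single when_def)
  \<comment> \<open>No edge of \<open>T\<close> contains \<open>u\<close>, so the exponent of
    \<open>u\<close> does not affect membership. This is the divisibility by the variable
    \<open>u\<close> needed for the cone.\<close>
  have b: "Poly_Mapping.single v 1 + c \<in> edge_multiples T" if "?a + c \<in> edge_multiples T" for c
  proof -
    have "Poly_Mapping.lookup (?a + c) x = Poly_Mapping.lookup (Poly_Mapping.single v 1 + c) x" if "x \<noteq> u" for x
      using that by (simp add: lookup_add lookup_single when_def)
    then show ?thesis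
      using that unfolding T_mem by metis
  qed
  \<comment> \<open>An edge of \<open>T\<close> in the support of \<open>?a + c\<close> either ends
    in \<open>v\<close>, and then its other end lies in \<open>W\<close> and in the support of
    \<open>c\<close>, or avoids \<open>v\<close> and lies in the support of \<open>c\<close>; there
    it meets \<open>W\<close> or is an edge of \<open>H\<close>. Conversely, an element of
    \<open>W\<close> in the support of \<open>c\<close> forms an edge of \<open>T\<close> with
    \<open>v\<close>.\<close>
  have colon: "{c. ?a + c \<in> edge_multiples T} = edge_multiples H \<union> variable_multiples W"
  proof (intro subset_antisym subsetI)
    fix c assume "c \<in> {c. ?a + c \<in> edge_multiples T}"
    then obtain x y where xy: "{x, y} \<in> edges G" "x \<noteq> u" "y \<noteq> u"
        "1 \<le> Poly_Mapping.lookup (?a + c) x" "1 \<le> Poly_Mapping.lookup (?a + c) y"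
      unfolding T_mem by auto
    show "c \<in> edge_multiples H \<union> variable_multiples W"
    proof (cases "c \<in> variable_multiples W")
      case False
      then have W: "w \<notin> W" if "1 \<le> Poly_Mapping.lookup c w" for w
        using that by (auto simp: mem_variable_multiples_iff)
      have "x \<noteq> v"
      proof
        assume "x = v"
        moreover have "x \<noteq> y"
          using xy(1) noloop by auto
        ultimately have "y \<in> W" "y \<noteq> v"
          using xy(1,3) vW[of y] by auto
        then show False
          using xy(3,5) W[of y] look[of c y] by auto
      qed
      moreover have "y \<noteq> v"
      proof
        assume "y = v"
        moreover have "x \<noteq> y"
          using xy(1) noloop by auto
        ultimately have "x \<in> W" "x \<noteq> v"
          using xy(1,2) vW[of x] by (auto simp: insert_commute)
        then show False
          using xy(2,4) W[of x] look[of c x] by auto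
      qed
      ultimately show ?thesis
        using xy W look by (auto simp: H_mem)
    qed simp
  next
    fix c assume "c \<in> edge_multiples H \<union> variable_multiples W"
    then consider "c \<in> edge_multiples H" | w where "w \<in> W" "1 \<le> Poly_Mapping.lookup c w"
      by (auto simp: mem_variable_multiples_iff)
    then show "c \<in> {c. ?a + c \<in> edge_multiples T}"
    proof cases
      case 1
      then obtain x y where xy: "{x, y} \<in> edges G" "{x, y} \<inter> ({u, v} \<union> W) = {}"
          "1 \<le> Poly_Mapping.lookup c x" "1 \<le> Poly_Mapping.lookup c y"
        unfolding H_mem by blast
      then have "x \<noteq> u" "y \<noteq> u"
        by auto
      moreover have "1 \<le> Poly_Mapping.lookup (?a + c) x" "1 \<le> Poly_Mapping.lookup (?a + c) y"
        using xy(3,4) by (simp_all only: look trans_le_add2)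
      ultimately show ?thesis
        unfolding T_mem mem_Collect_eq using xy(1) by blast
    next
      case 2
      then have "{v, w} \<in> edges G" "w \<noteq> u"
        using vW N(2) by auto
      moreover have "1 \<le> Poly_Mapping.lookup (?a + c) v" "1 \<le> Poly_Mapping.lookup (?a + c) w"
        using 2(2) by (simp_all only: look trans_le_add2) simp
      ultimately show ?thesis
        unfolding T_mem mem_Collect_eq using \<open>u \<noteq> v\<close> by blast
    qed
  qed
  \<comment> \<open>If \<open>?a\<close> were in the ideal of \<open>T\<close>, the exponent 0 would
    be in the colon set.\<close>
  have "0 \<notin> edge_multiples H \<union> variable_multiples W"
    by (simp add: mem_edge_multiples_iff[OF noloop'(2)] mem_variable_multiples_iff)
  then have "?a \<notin> edge_multiples T"
    using colon by (metis (no_types, lifting) add_0_right mem_Collect_eq)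
  then have "graded_betti (monomial_ideal (edge_multiples T \<union> multiples ?a) :: ('v, 'k) mpoly set) i j =
      graded_betti (monomial_ideal (edge_multiples T) :: ('v, 'k) mpoly set) i j +
      graded_betti (monomial_ideal {c. ?a + c \<in> edge_multiples T} :: ('v, 'k) mpoly set) (i - 1)
        (j - int (monomial_degree ?a))"
    by (intro graded_betti_add_monomial[OF finite_edge_exponents edge_multiples_def refl b])
  moreover have "monomial_degree ?a = 2"
    by (simp add: monomial_degree_add)
  moreover have "W \<inter> \<Union>(edges H) = {}"
    by (auto simp: H_def delete_verts_def)
  ultimately show ?thesis
    unfolding edge_ideal_eq_monomial_ideal G_eq colon T_def[symmetric] H_def[symmetric]
    by (simp add: graded_betti_add_variables[OF noloop'(2)])
qed

theorem corollary3p9: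
  fixes G T H :: "'v::finite graph" and e :: "'v set" and u v :: 'v
    and w :: "nat \<Rightarrow> 'v" and n i j :: nat
  assumes "forest G" and "verts G = UNIV"
    and "is_leaf G e" and "e = {u, v}" and "degree G u = 1"
    and "degree G v = n" and "neighbors G v = insert u (w ` {1..n-1})"
    and "T = delete_verts G {u}"
    and "H = delete_verts G ({u, v} \<union> w ` {1..n-1})"
    and "1 \<le> i"
  shows "graded_betti (edge_ideal G :: ('v, 'k::field) mpoly set) (int i) (int j) =
           graded_betti (edge_ideal T :: ('v, 'k) mpoly set) (int i) (int j) +
           (\<Sum>l=0..i. ((n - 1) choose l) *
              graded_betti (edge_ideal H :: ('v, 'k) mpoly set)
                (int i - int l - 1) (int j - 2 - int l))"
proof -
  let ?W = "w ` {1..n-1}"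
  let ?f = "\<lambda>l. ((n - 1) choose l) *
      graded_betti (edge_ideal H :: ('v, 'k) mpoly set) (int i - int l - 1) (int j - 2 - int l)"
  have G: "finite_simple_graph G" and uv: "{u, v} \<in> edges G"
    using assms by (auto simp: forest_def is_leaf_def)
  have card2: "card e = 2" if "e \<in> edges G" for e
    using G that by (auto simp: finite_simple_graph_def)
  have noloop: "{x} \<notin> edges G" for x
    using card2[of "{x}"] by auto
  have card: "card (insert u ?W) = n"
    using card_neighbors[of G v, OF noloop card2] assms by simp
  have "card ?W \<le> n - 1"
    using card_image_le[of "{1..n-1}" w] by simp
  moreover have "card (insert u ?W) \<noteq> 0"
    by (simp only: card_eq_0_iff) simp
  then have "n \<noteq> 0"
    unfolding card .
  \<comment> \<open>At most \<open>n - 1\<close> values of \<open>w\<close> together with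
    \<open>u\<close> give \<open>n > 0\<close> neighbors. Hence \<open>u\<close> is not among these
    values and they are pairwise distinct.\<close>
  ultimately have W: "u \<notin> ?W" "card ?W = n - 1"
    using card by (auto simp: card_insert_if split: if_splits)
  have "graded_betti (edge_ideal G :: ('v, 'k) mpoly set) (int i) (int j) =
      graded_betti (edge_ideal T :: ('v, 'k) mpoly set) (int i) (int j) + (\<Sum>l\<le>n - 1. ?f l)"
    using graded_betti_leaf[OF G uv \<open>degree G u = 1\<close> assms(7) W(1), of "int i" "int j", where ?'k = 'k]
    unfolding W(2) assms(8,9)[symmetric] by (simp add: algebra_simps)
  \<comment> \<open>The ranges may differ either way: terms with \<open>l > n - 1\<close> have
    binomial coefficient 0, and terms with \<open>l > i\<close> have homological index below -1. The
    term \<open>l = i\<close> uses the convention at -1.\<close>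
  also have "(\<Sum>l\<le>n - 1. ?f l) = (\<Sum>l=0..i. ?f l)"
    by (rule sum.mono_neutral_cong) (auto simp: graded_betti_def)
  finally show ?thesis .
qed

end
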